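(* There is a universal constant $K>0$ such that for all positive integers $n,m$ and every partial Boolean function $f:\{0,1\}^n\times\{0,1\}^m\to\{0,1,\bot\}$ (where $\bot$ means "undefined") we have $$D^{A\to B}(f)\le K\cdot Q^{A\to B,*}(f)\cdot m .$$
   Context: A partial Boolean function is a map $f:\{0,1\}^n\times\{0,1\}^m\to\{0,1,\bot\}$, where $f(x,y)=\bot$ means that $f$ is undefined at $(x,y)$. Alice holds $x\in\{0,1\}^n$ and Bob holds $y\in\{0,1\}^m$. In a one-way protocol (from Alice to Bob) Alice sends a single message to Bob, who then outputs a bit. A protocol is required to be correct only on inputs $(x,y)$ with $f(x,y)\neq\bot$; on the other inputs its behaviour is arbitrary. $D^{A\to B}(f)$ is the deterministic one-way communication complexity: the least number of bits in Alice's message (a function of $x$ alone) such that Bob, from the message and $y$, outputs $f(x,y)$ for all $(x,y)$ with $f(x,y)\ne\bot$. $Q^{A\to B,*}(f)$ is the entanglement-assisted quantum one-way communication complexity with error $1/3$: Alice and Bob initially share an arbitrary bipartite quantum state, independent of the inputs, on an arbitrary (unrestricted, finite) number of qubits. Alice applies a quantum operation depending on $x$ to her part and sends $q$ qubits to Bob, who performs a measurement depending on $y$ on the received qubits together with his part of the shared state; the measurement result is the output. For every $(x,y)$ with $f(x,y)\neq\bot$ the output must equal $f(x,y)$ with probability at least $2/3$. $Q^{A\to B,*}(f)$ is the minimum possible $q$. *)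

theory Defs
  imports "Jordan_Normal_Form.Schur_Decomposition"
begin

text \<open>
  Inputs are Boolean lists of lengths \<open>n\<close> and \<open>m\<close>; a partial Boolean function has type
  \<open>bool list \<Rightarrow> bool list \<Rightarrow> bool option\<close>, where \<open>None\<close> stands for \<open>\<bottom>\<close>.  Its values on lists
  of other lengths are never inspected.
\<close>

definition det_protocol ::
  "nat \<Rightarrow> nat \<Rightarrow> (bool list \<Rightarrow> bool list \<Rightarrow> bool option) \<Rightarrow> nat \<Rightarrow>
   (bool list \<Rightarrow> bool list) \<Rightarrow> (bool list \<Rightarrow> bool list \<Rightarrow> bool) \<Rightarrow> bool" where
  "det_protocol n m f c msg out \<longleftrightarrow>
     (\<forall>x. length x = n \<longrightarrow> length (msg x) = c) \<and>
     (\<forall>x y z. length x = n \<longrightarrow> length y = m \<longrightarrow> f x y = Some z \<longrightarrow> out (msg x) y = z)"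

definition det_one_way :: "nat \<Rightarrow> nat \<Rightarrow> (bool list \<Rightarrow> bool list \<Rightarrow> bool option) \<Rightarrow> nat" where
  "det_one_way n m f = (LEAST c. \<exists>msg out. det_protocol n m f c msg out)"


definition mat_trace :: "complex mat \<Rightarrow> complex" where
  "mat_trace A = (\<Sum>i<dim_row A. A $$ (i, i))"

text \<open>
  The order on \<open>complex\<close> is the one of \<open>Complex_Order\<close>: \<open>0 \<le> z\<close> says that \<open>z\<close> is real and
  nonnegative.  So the condition below also forces \<open>A\<close> to be Hermitian.
\<close>

definition psd :: "nat \<Rightarrow> complex mat \<Rightarrow> bool" where
  "psd d A \<longleftrightarrow> A \<in> carrier_mat d d \<and> (\<forall>v \<in> carrier_vec d. 0 \<le> (A *\<^sub>v v) \<bullet>c v)"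

definition density :: "nat \<Rightarrow> complex mat \<Rightarrow> bool" where
  "density d \<rho> \<longleftrightarrow> psd d \<rho> \<and> mat_trace \<rho> = 1"

definition kron :: "complex mat \<Rightarrow> complex mat \<Rightarrow> complex mat" where
  "kron A B = mat (dim_row A * dim_row B) (dim_col A * dim_col B)
     (\<lambda>(i, j). A $$ (i div dim_row B, j div dim_col B) * B $$ (i mod dim_row B, j mod dim_col B))"

definition mat_sum :: "nat \<Rightarrow> complex mat list \<Rightarrow> complex mat" where
  "mat_sum d As = foldr (+) As (0\<^sub>m d d)"

text \<open>
  A quantum operation (completely positive trace-preserving map) from dimension \<open>d\<close> to
  dimension \<open>d'\<close>, given by a finite list of Kraus operators.
\<close>

definition quantum_op :: "nat \<Rightarrow> nat \<Rightarrow> complex mat list \<Rightarrow> bool" where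
  "quantum_op d d' Ks \<longleftrightarrow>
     set Ks \<subseteq> carrier_mat d' d \<and> mat_sum d (map (\<lambda>K. mat_adjoint K * K) Ks) = 1\<^sub>m d"

text \<open>The operation acts on the first tensor factor; the second one has dimension \<open>e\<close>.\<close>

definition apply_first :: "nat \<Rightarrow> nat \<Rightarrow> complex mat list \<Rightarrow> complex mat \<Rightarrow> complex mat" where
  "apply_first d' e Ks \<rho> =
     mat_sum (d' * e) (map (\<lambda>K. kron K (1\<^sub>m e) * \<rho> * mat_adjoint (kron K (1\<^sub>m e))) Ks)"

definition binary_povm :: "nat \<Rightarrow> (bool \<Rightarrow> complex mat) \<Rightarrow> bool" where
  "binary_povm d M \<longleftrightarrow> psd d (M False) \<and> psd d (M True) \<and> M False + M True = 1\<^sub>m d"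

definition outcome_prob :: "(bool \<Rightarrow> complex mat) \<Rightarrow> complex mat \<Rightarrow> bool \<Rightarrow> real" where
  "outcome_prob M \<sigma> z = Re (mat_trace (M z * \<sigma>))"

text \<open>
  The shared state \<open>\<rho>\<close> lives on \<open>a\<close> qubits of Alice (first factor) and \<open>b\<close> qubits of Bob
  (second factor); \<open>Ks x\<close> maps Alice's \<open>a\<close> qubits to the \<open>q\<close> qubits of the message, and \<open>M y\<close>
  measures the message qubits together with Bob's \<open>b\<close> qubits.
\<close>

definition ent_protocol ::
  "nat \<Rightarrow> nat \<Rightarrow> (bool list \<Rightarrow> bool list \<Rightarrow> bool option) \<Rightarrow> nat \<Rightarrow> nat \<Rightarrow> nat \<Rightarrow> complex mat \<Rightarrow>
   (bool list \<Rightarrow> complex mat list) \<Rightarrow> (bool list \<Rightarrow> bool \<Rightarrow> complex mat) \<Rightarrow> bool" where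
  "ent_protocol n m f q a b \<rho> Ks M \<longleftrightarrow>
     density (2 ^ a * 2 ^ b) \<rho> \<and>
     (\<forall>x. length x = n \<longrightarrow> quantum_op (2 ^ a) (2 ^ q) (Ks x)) \<and>
     (\<forall>y. length y = m \<longrightarrow> binary_povm (2 ^ q * 2 ^ b) (M y)) \<and>
     (\<forall>x y z. length x = n \<longrightarrow> length y = m \<longrightarrow> f x y = Some z \<longrightarrow>
        outcome_prob (M y) (apply_first (2 ^ q) (2 ^ b) (Ks x) \<rho>) z \<ge> 2 / 3)"

definition ent_one_way :: "nat \<Rightarrow> nat \<Rightarrow> (bool list \<Rightarrow> bool list \<Rightarrow> bool option) \<Rightarrow> nat" where
  "ent_one_way n m f = (LEAST q. \<exists>a b \<rho> Ks M. ent_protocol n m f q a b \<rho> Ks M)"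

text \<open>
  Both minima are attained: sending all of \<open>x\<close>, classically or as a basis state, is a
  correct protocol.
\<close>

lemma det_protocol_exists: "\<exists>msg out. det_protocol n m f n msg out"
  by (rule exI[of _ id], rule exI[of _ "\<lambda>x y. the (f x y)"]) (auto simp: det_protocol_def)

lemma psd_diag: "psd d (mat d d (\<lambda>(i, j). if i = j \<and> P i then 1 else 0))"
proof -
  have "0 \<le> (mat d d (\<lambda>(i, j). if i = j \<and> P i then 1 else 0) *\<^sub>v v) \<bullet>c v"
    if v: "v \<in> carrier_vec d" for v :: "complex vec"
  proof -
    have row: "(\<Sum>j<d. (if i = j \<and> P i then 1 else 0) * v $ j) = (if P i then v $ i else 0)"
      if "i < d" for i
    proof -
      have "(\<Sum>j<d. (if i = j \<and> P i then 1 else 0) * v $ j)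
          = (\<Sum>j<d. if i = j then (if P i then v $ j else 0) else 0)"
        by (intro sum.cong) auto
      then show ?thesis using that by (simp add: sum.delta')
    qed
    have "(mat d d (\<lambda>(i, j). if i = j \<and> P i then 1 else 0) *\<^sub>v v) \<bullet>c v
        = (\<Sum>i<d. (\<Sum>j<d. (if i = j \<and> P i then 1 else 0) * v $ j) * cnj (v $ i))"
      using v by (auto simp: scalar_prod_def lessThan_atLeast0 intro!: sum.cong)
    also have "\<dots> = (\<Sum>i<d. (if P i then v $ i * cnj (v $ i) else 0))"
      by (intro sum.cong) (simp_all add: row)
    also have "\<dots> \<ge> 0"
      by (intro sum_nonneg) (auto simp: complex_mult_cnj less_eq_complex_def)
    finally show ?thesis .
  qed
  then show ?thesis by (auto simp: psd_def)
qed

lemma mat_adjoint_eq: "mat_adjoint A = mat (dim_col A) (dim_row A) (\<lambda>(i, j). cnj (A $$ (j, i)))"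
  by (auto simp: mat_adjoint_def mat_of_rows_def intro!: eq_matI)

lemma ent_protocol_exists: "\<exists>a b \<rho> Ks M. ent_protocol n m f n a b \<rho> Ks M"
proof -
  let ?S = "{x :: bool list. length x = n}"
  have fin: "finite ?S" and cS: "card ?S = 2 ^ n"
    using finite_lists_length_eq[of "UNIV :: bool set" n]
      card_lists_length_eq[of "UNIV :: bool set" n] by simp_all
  obtain g where g: "bij_betw g ?S {0..<2 ^ n :: nat}"
    using ex_bij_betw_finite_nat[OF fin] cS by auto
  define h where "h = inv_into ?S g"
  have hg: "h (g x) = x" if "length x = n" for x
    using that g unfolding h_def by (simp add: bij_betw_def)
  have g_less: "g x < 2 ^ n" if "length x = n" for x
    using that g by (auto simp: bij_betw_def)
  define Ks where "Ks x = [mat (2 ^ n) 1 (\<lambda>(i, j). if i = g x then 1 else 0) :: complex mat]" for x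
  define M where "M y z = (mat (2 ^ n) (2 ^ n)
    (\<lambda>(i, j). if i = j \<and> (f (h i) y = Some True) = z then 1 else 0) :: complex mat)" for y z
  have "density (2 ^ 0 * 2 ^ 0) (1\<^sub>m 1)"
    using psd_diag[of 1 "\<lambda>_. True"] by (simp add: density_def mat_trace_def one_mat_def)
  moreover have "quantum_op (2 ^ 0) (2 ^ n) (Ks x)" if "length x = n" for x
  proof -
    let ?A = "mat (2 ^ n) 1 (\<lambda>(i, j). if i = g x then 1 else 0) :: complex mat"
    have "(mat_adjoint ?A * ?A) $$ (0, 0) = (\<Sum>i<2 ^ n. if i = g x then 1 else 0)"
      by (auto simp: mat_adjoint_eq scalar_prod_def lessThan_atLeast0
          simp del: sum.delta intro!: sum.cong)
    also have "\<dots> = 1" using g_less[OF that] by (simp add: sum.delta)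
    finally have entry: "(mat_adjoint ?A * ?A) $$ (0, 0) = 1" .
    have A: "mat_adjoint ?A * ?A = 1\<^sub>m 1"
    proof (rule eq_matI)
      fix i j assume "i < dim_row (1\<^sub>m 1 :: complex mat)" "j < dim_col (1\<^sub>m 1 :: complex mat)"
      then have "i = 0" "j = 0" by auto
      with entry show "(mat_adjoint ?A * ?A) $$ (i, j) = 1\<^sub>m 1 $$ (i, j)" by simp
    qed (simp_all add: mat_adjoint_eq)
    show ?thesis
      unfolding quantum_op_def Ks_def list.map mat_sum_def foldr.simps o_apply power_0 A by simp
  qed
  moreover have "binary_povm (2 ^ n * 2 ^ 0) (M y)" for y
    using psd_diag by (auto simp: binary_povm_def M_def intro!: eq_matI)
  moreover have "outcome_prob (M y) (apply_first (2 ^ n) (2 ^ 0) (Ks x) (1\<^sub>m 1)) z = 1"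
    if x: "length x = n" and fz: "f x y = Some z" for x y z
  proof -
    have K: "kron (mat (2 ^ n) 1 (\<lambda>(i, j). if i = g x then 1 else 0)) (1\<^sub>m 1)
        = mat (2 ^ n) 1 (\<lambda>(i, j). if i = g x then 1 else 0)"
      by (auto simp: kron_def intro!: eq_matI)
    have s: "apply_first (2 ^ n) (2 ^ 0) (Ks x) (1\<^sub>m 1)
        = mat (2 ^ n) (2 ^ n) (\<lambda>(i, j). if i = g x \<and> j = g x then 1 else 0)" (is "_ = ?s")
      unfolding apply_first_def Ks_def list.map power_0 K
      by (auto simp: mat_sum_def mat_adjoint_eq scalar_prod_def intro!: eq_matI)
    have "M y z * ?s = ?s"
    proof (rule eq_matI)
      fix i j assume "i < dim_row ?s" "j < dim_col ?s"
      then have ij: "i < 2 ^ n" "j < 2 ^ n" by auto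
      then have "(M y z * ?s) $$ (i, j)
          = (\<Sum>k<2 ^ n. if k = g x then M y z $$ (i, k) * (if j = g x then 1 else 0) else 0)"
        by (auto simp: M_def scalar_prod_def lessThan_atLeast0
            simp del: sum.delta intro!: sum.cong)
      also have "\<dots> = M y z $$ (i, g x) * (if j = g x then 1 else 0)"
        using g_less[OF x] by (simp add: sum.delta)
      also have "\<dots> = ?s $$ (i, j)"
        using ij g_less[OF x] hg[OF x] fz by (simp add: M_def)
      finally show "(M y z * ?s) $$ (i, j) = ?s $$ (i, j)" .
    qed (auto simp: M_def)
    then have "outcome_prob (M y) (apply_first (2 ^ n) (2 ^ 0) (Ks x) (1\<^sub>m 1)) z = Re (mat_trace ?s)"
      unfolding outcome_prob_def s by (rule arg_cong)
    also have "mat_trace ?s = (\<Sum>i<2 ^ n. if i = g x then 1 else 0)"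
      by (auto simp: mat_trace_def simp del: sum.delta intro!: sum.cong)
    also have "\<dots> = 1" using g_less[OF x] by (simp add: sum.delta)
    finally show ?thesis by simp
  qed
  ultimately have "ent_protocol n m f n 0 0 (1\<^sub>m 1) Ks M"
    by (auto simp: ent_protocol_def)
  then show ?thesis by blast
qed

end

theory Submission
  imports Defs "Jordan_Normal_Form.Spectral_Radius"
begin

text \<open>
  Bob runs Littlestone's optimal online learner on the partial functions \<open>f x\<close>, and Alice sends the
  points at which it errs, so the deterministic cost is at most \<open>m + 1\<close> times the largest depth \<open>N\<close>
  of a mistake tree.  It remains to show \<open>N = O(q)\<close>.  Let \<open>\<sigma>\<^sub>x\<close> be Bob's state after receiving the
  message, and \<open>\<omega>\<close> the product of the maximally mixed message and Bob's reduced state.  By no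
  signalling \<open>\<sigma>\<^sub>x \<le> 4\<^sup>q \<omega>\<close>, so the relative entropy \<open>S(\<sigma>\<^sub>x \<parallel> \<omega>)\<close> is at most \<open>2 q ln 2\<close>.  Going up a mistake
  tree, averaging the states of the two children, which one measurement distinguishes with constant
  bias, decreases the mean relative entropy to \<open>\<omega>\<close> by a constant (Pinsker), and it never becomes
  negative.

  Matrices are functions of two indices below \<open>d\<close>.  All states are mixed with the maximally mixed state
  first, so that logarithms are only taken of positive eigenvalues.
\<close>

section \<open>The spectral theorem\<close>

definition ip :: "nat \<Rightarrow> (nat \<Rightarrow> complex) \<Rightarrow> (nat \<Rightarrow> complex) \<Rightarrow> complex" where
  "ip d u v = (\<Sum>i<d. cnj (u i) * v i)"

definition mv :: "nat \<Rightarrow> (nat \<Rightarrow> nat \<Rightarrow> complex) \<Rightarrow> (nat \<Rightarrow> complex) \<Rightarrow> nat \<Rightarrow> complex" where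
  "mv d A v i = (\<Sum>j<d. A i j * v j)"

definition mm :: "nat \<Rightarrow> (nat \<Rightarrow> nat \<Rightarrow> complex) \<Rightarrow> (nat \<Rightarrow> nat \<Rightarrow> complex) \<Rightarrow> nat \<Rightarrow> nat \<Rightarrow> complex" where
  "mm d A B i j = (\<Sum>k<d. A i k * B k j)"

definition herm :: "nat \<Rightarrow> (nat \<Rightarrow> nat \<Rightarrow> complex) \<Rightarrow> bool" where
  "herm d A \<longleftrightarrow> (\<forall>i<d. \<forall>j<d. A i j = cnj (A j i))"

text \<open>The trace of the product \<open>A B\<close>. For a state \<open>A\<close>,
  \<open>tr d E A\<close> is the expectation of the observable \<open>E\<close>.\<close>

definition tr :: "nat \<Rightarrow> (nat \<Rightarrow> nat \<Rightarrow> complex) \<Rightarrow> (nat \<Rightarrow> nat \<Rightarrow> complex) \<Rightarrow> complex" where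
  "tr d A B = (\<Sum>i<d. \<Sum>j<d. A i j * B j i)"

definition spec :: "nat \<Rightarrow> (nat \<Rightarrow> real) \<Rightarrow> (nat \<Rightarrow> nat \<Rightarrow> complex) \<Rightarrow> nat \<Rightarrow> nat \<Rightarrow> complex" where
  "spec d a u i j = (\<Sum>k<d. of_real (a k) * u k i * cnj (u k j))"

text \<open>Orthonormality and completeness are recorded side by side, so that inner products of
  basis vectors and Parseval's identity can both be read off directly.\<close>

definition onb :: "nat \<Rightarrow> (nat \<Rightarrow> nat \<Rightarrow> complex) \<Rightarrow> bool" where
  "onb d u \<longleftrightarrow> (\<forall>k<d. \<forall>l<d. ip d (u k) (u l) = of_bool (k = l)) \<and>
     (\<forall>i<d. \<forall>j<d. (\<Sum>k<d. u k i * cnj (u k j)) = of_bool (i = j))"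

definition spectral :: "nat \<Rightarrow> (nat \<Rightarrow> nat \<Rightarrow> complex) \<Rightarrow> (nat \<Rightarrow> real) \<Rightarrow> (nat \<Rightarrow> nat \<Rightarrow> complex) \<Rightarrow> bool" where
  "spectral d A a u \<longleftrightarrow> onb d u \<and> (\<forall>i<d. \<forall>j<d. A i j = spec d a u i j)"

lemma hermD: "herm d A \<Longrightarrow> i < d \<Longrightarrow> j < d \<Longrightarrow> cnj (A i j) = A j i"
  by (metis herm_def)

lemma sum_of_bool_mult [simp]:
  fixes g :: "nat \<Rightarrow> 'a :: semiring_1"
  shows "(\<Sum>i<d. of_bool (i = k) * g i) = (if k < d then g k else 0)"
    "(\<Sum>i<d. of_bool (k = i) * g i) = (if k < d then g k else 0)"
    "(\<Sum>i<d. g i * of_bool (i = k)) = (if k < d then g k else 0)"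
    "(\<Sum>i<d. g i * of_bool (k = i)) = (if k < d then g k else 0)"
  by (simp_all add: of_bool_def if_distrib[of "\<lambda>x. x * _"] if_distrib[of "\<lambda>x. _ * x"] sum.delta sum.delta' cong: if_cong)

lemma mm_assoc: "mm d (mm d A B) C = mm d A (mm d B C)"
proof (intro ext)
  fix i j
  have "mm d (mm d A B) C i j = (\<Sum>k<d. \<Sum>l<d. A i l * B l k * C k j)"
    by (simp add: mm_def sum_distrib_right)
  also have "\<dots> = (\<Sum>l<d. \<Sum>k<d. A i l * B l k * C k j)"
    by (rule sum.swap)
  also have "\<dots> = mm d A (mm d B C) i j"
    by (simp add: mm_def sum_distrib_left mult.assoc)
  finally show "mm d (mm d A B) C i j = mm d A (mm d B C) i j" .
qed

lemma mv_mm: "mv d (mm d A B) v = mv d A (mv d B v)"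
  using mm_assoc[of d A B "\<lambda>i _. v i"] by (simp add: mv_def mm_def fun_eq_iff)

lemma ip_cnj: "cnj (ip d u v) = ip d v u"
  by (simp add: ip_def mult.commute)

lemma ip_self: "ip d v v = of_real (\<Sum>i<d. (cmod (v i))\<^sup>2)"
  unfolding ip_def of_real_sum by (intro sum.cong refl) (metis complex_norm_square mult.commute)

lemma herm_ip: "herm d E \<Longrightarrow> ip d (mv d E x) y = ip d x (mv d E y)"
proof -
  assume E: "herm d E"
  have "ip d (mv d E x) y = (\<Sum>i<d. \<Sum>j<d. cnj (E i j) * cnj (x j) * y i)"
    by (simp only: ip_def mv_def cnj_sum sum_distrib_right complex_cnj_mult)
  also have "\<dots> = (\<Sum>i<d. \<Sum>j<d. E j i * cnj (x j) * y i)"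
    by (intro sum.cong refl) (simp add: hermD[OF E])
  also have "\<dots> = (\<Sum>j<d. \<Sum>i<d. E j i * cnj (x j) * y i)" by (rule sum.swap)
  also have "\<dots> = ip d x (mv d E y)"
    by (simp only: ip_def mv_def sum_distrib_left mult_ac)
  finally show ?thesis .
qed

lemma eigenvector_exists:
  assumes "0 < n"
  obtains e v where "\<exists>i<n. v i \<noteq> 0" "\<And>i. i < n \<Longrightarrow> mv n A v i = e * v i"
proof -
  define M where "M = mat n n (\<lambda>(i, j). A i j)"
  have M: "M \<in> carrier_mat n n" by (simp add: M_def)
  from spectrum_non_empty[OF M assms] obtain e where "eigenvalue M e"
    by (auto simp: spectrum_def)
  then obtain v where v: "eigenvector M v e" by (auto simp: eigenvalue_def)
  then have vc: "v \<in> carrier_vec n" and v0: "v \<noteq> 0\<^sub>v n" and Mv: "M *\<^sub>v v = e \<cdot>\<^sub>v v"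
    using M by (auto simp: eigenvector_def)
  show thesis
  proof (rule that[of "\<lambda>i. v $ i" e])
    show "\<exists>i<n. v $ i \<noteq> 0"
    proof (rule ccontr)
      assume "\<not> ?thesis"
      then have "v = 0\<^sub>v n" using vc by (intro eq_vecI) auto
      with v0 show False ..
    qed
    fix i assume i: "i < n"
    have "(M *\<^sub>v v) $ i = mv n A (\<lambda>i. v $ i) i"
      using i vc by (auto simp: M_def mv_def scalar_prod_def lessThan_atLeast0)
    moreover have "(e \<cdot>\<^sub>v v) $ i = e * v $ i" using i vc by auto
    ultimately show "mv n A (\<lambda>i. v $ i) i = e * v $ i" using Mv by simp
  qed
qed

text \<open>A phase factor makes the first coordinate real. A Hermitian \<open>H\<close> whose first
  column is \<open>v\<close> has the real diagonal entry \<open>v 0\<close>, so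
  \<open>householder\<close> needs this normalisation.\<close>

lemma unit_eigenvector_exists:
  assumes n: "0 < n"
  obtains e v where "ip n v v = 1" "v 0 \<in> \<real>" "\<And>i. i < n \<Longrightarrow> mv n A v i = e * v i"
proof -
  obtain e v where v: "\<exists>i<n. v i \<noteq> 0" and ev: "\<And>i. i < n \<Longrightarrow> mv n A v i = e * v i"
    using eigenvector_exists[OF n] by metis
  define s where "s = (\<Sum>i<n. (cmod (v i))\<^sup>2)"
  have s: "s > 0" unfolding s_def using v
    by (auto intro!: sum_pos2)
  define p where "p = (if v 0 = 0 then 1 else cnj (sgn (v 0)))"
  have p: "cmod p = 1" by (simp add: p_def norm_sgn)
  define c where "c = p / of_real (sqrt s)"
  show thesis
  proof (rule that[of "\<lambda>i. c * v i" e])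
    have "ip n (\<lambda>i. c * v i) (\<lambda>i. c * v i) = of_real ((cmod c)\<^sup>2 * s)"
      unfolding ip_self by (simp add: norm_mult power_mult_distrib sum_distrib_left s_def)
    also have "(cmod c)\<^sup>2 * s = 1" using s p by (simp add: c_def norm_divide power_divide)
    finally show "ip n (\<lambda>i. c * v i) (\<lambda>i. c * v i) = 1" by simp
    have "p * v 0 \<in> \<real>"
    proof (cases "v 0 = 0")
      case False
      have "cnj (v 0) * v 0 = of_real ((cmod (v 0))\<^sup>2)"
        by (metis complex_norm_square mult.commute)
      moreover have "p = cnj (v 0) / of_real (cmod (v 0))" using False by (simp add: p_def sgn_eq)
      ultimately have "p * v 0 = of_real ((cmod (v 0))\<^sup>2 / cmod (v 0))" by simp
      then show ?thesis by (metis Reals_of_real)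
    qed auto
    then show "c * v 0 \<in> \<real>" by (simp add: c_def)
    fix i assume "i < n"
    then have "mv n A v i = e * v i" by (rule ev)
    then show "mv n A (\<lambda>i. c * v i) i = e * (c * v i)"
      unfolding mv_def by (simp add: sum_distrib_left[symmetric] mult.left_commute)
  qed
qed

lemma householder:
  assumes n: "0 < n" and v1: "ip n v v = 1" and v0: "v 0 \<in> \<real>"
  obtains H where "herm n H" "\<And>i j. i < n \<Longrightarrow> j < n \<Longrightarrow> mm n H H i j = of_bool (i = j)"
    "\<And>i. i < n \<Longrightarrow> H i 0 = v i"
proof -
  \<comment> \<open>\<open>H\<close> below is the reflection that exchanges \<open>v\<close> and the first basis vector.\<close>
  define w where "w i = v i - of_bool (i = 0)" for i
  obtain r where r: "v 0 = of_real r" using v0 by (auto elim: Reals_cases)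
  have "ip n w w = (\<Sum>i<n. cnj (v i) * v i - of_bool (i = 0) * v i - of_bool (i = 0) * cnj (v i)
      + of_bool (i = 0) * 1)"
    by (auto simp: ip_def w_def algebra_simps intro!: sum.cong)
  also have "\<dots> = ip n v v - v 0 - cnj (v 0) + 1"
    unfolding sum.distrib sum_subtractf sum_of_bool_mult using n by (simp add: ip_def)
  also have "\<dots> = of_real (2 - 2 * r)" using r v1 by simp
  finally have ww: "ip n w w = of_real (2 - 2 * r)" .
  \<comment> \<open>Away from \<open>r = 1\<close> this is the Householder coefficient 2 / |w|^2, as
    |w|^2 = 2 - 2 r. For \<open>r = 1\<close> the vector \<open>w\<close> vanishes and the
    reflection degenerates to the identity.\<close>
  define t where "t = (if r = 1 then 0 else 1 / (1 - r))"
  define H where "H i j = of_bool (i = j) - of_real t * w i * cnj (w j)" for i j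
  have "t * (t * (2 - 2 * r)) = 2 * t"
  proof (cases "r = 1")
    case False
    then have "t * (2 - 2 * r) = 2" by (simp add: t_def divide_simps)
    then show ?thesis by simp
  qed (simp add: t_def)
  then have key: "of_real t * (of_real t * ip n w w) = 2 * of_real t"
    unfolding ww by (metis of_real_mult of_real_numeral)
  show thesis
  proof (rule that[of H])
    show "herm n H" by (auto simp: herm_def H_def mult.commute mult.left_commute)
    show "mm n H H i j = of_bool (i = j)" if "i < n" "j < n" for i j
    proof -
      have "mm n H H i j = (\<Sum>k<n. of_bool (i = k) * H k j - of_real t * w i * (cnj (w k) * of_bool (k = j))
         + of_real t * w i * (of_real t * cnj (w j)) * (cnj (w k) * w k))"
        unfolding mm_def by (intro sum.cong refl) (simp add: H_def algebra_simps)
      also have "\<dots> = H i j - of_real t * w i * cnj (w j) + w i * cnj (w j) * (of_real t * (of_real t * ip n w w))"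
        unfolding sum.distrib sum_subtractf sum_distrib_left[symmetric] sum_of_bool_mult using that
        by (simp add: ip_def)
      finally show ?thesis unfolding key by (simp add: H_def algebra_simps)
    qed
    show "H i 0 = v i" if "i < n" for i
    proof (cases "r = 1")
      case True
      then have "(\<Sum>i<n. (cmod (w i))\<^sup>2) = 0" using ww unfolding ip_self of_real_eq_iff by simp
      then have "w i = 0" using that by (simp add: sum_nonneg_eq_0_iff)
      then show ?thesis by (simp add: H_def w_def)
    next
      case False
      have "cnj (w 0) = of_real (r - 1)" using r by (simp add: w_def)
      moreover have "t * (r - 1) = -1" using False by (simp add: t_def field_simps)
      ultimately have "of_real t * cnj (w 0) = (-1 :: complex)"
        by (metis of_real_mult of_real_minus of_real_1)
      then have "of_real t * w i * cnj (w 0) = - w i" by (metis mult.commute mult.left_commute mult_minus1_right)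
      then show ?thesis by (simp add: H_def w_def)
    qed
  qed
qed

lemma herm_conj:
  assumes H: "herm n H" and A: "herm n A"
  shows "herm n (mm n H (mm n A H))"
proof -
  have "mm n H (mm n A H) i j = cnj (mm n H (mm n A H) j i)" if "i < n" "j < n" for i j
  proof -
    have "cnj (mm n H (mm n A H) j i) = (\<Sum>k<n. \<Sum>l<n. cnj (H j k * A k l * H l i))"
      by (simp add: mm_def sum_distrib_left mult.assoc)
    also have "\<dots> = (\<Sum>k<n. \<Sum>l<n. H i l * A l k * H k j)"
      using that by (intro sum.cong refl) (simp add: hermD[OF H] hermD[OF A] mult.commute mult.left_commute)
    also have "\<dots> = (\<Sum>l<n. \<Sum>k<n. H i l * A l k * H k j)" by (rule sum.swap)
    also have "\<dots> = mm n H (mm n A H) i j" by (simp add: mm_def sum_distrib_left mult.assoc)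
    finally show ?thesis ..
  qed
  then show ?thesis unfolding herm_def by blast
qed

text \<open>Deflation: conjugating by the reflection whose first column is a unit eigenvector clears
  the first row and column off the diagonal. The induction hypothesis diagonalises the remaining
  block, and the reflection carries the eigenbasis back.\<close>

lemma spectral_theorem:
  assumes "herm n A"
  shows "\<exists>a u. spectral n A a u"
  using assms
proof (induction n arbitrary: A)
  case 0
  then show ?case by (simp add: spectral_def onb_def)
next
  case (Suc n)
  let ?n = "Suc n"
  obtain e v where v1: "ip ?n v v = 1" and v0: "v 0 \<in> \<real>"
    and ev: "\<And>i. i < ?n \<Longrightarrow> mv ?n A v i = e * v i"
    using unit_eigenvector_exists[of ?n A] by blast
  obtain H where H: "herm ?n H" and HH: "\<And>i j. i < ?n \<Longrightarrow> j < ?n \<Longrightarrow> mm ?n H H i j = of_bool (i = j)"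
    and H0: "\<And>i. i < ?n \<Longrightarrow> H i 0 = v i"
    using householder[OF _ v1 v0] by blast
  define B where "B = mm ?n H (mm ?n A H)"
  have hB: "herm ?n B" unfolding B_def by (rule herm_conj[OF H Suc.prems])
  have B0: "B i 0 = e * of_bool (i = 0)" if i: "i < ?n" for i
  proof -
    have AH: "mm ?n A H k 0 = e * H k 0" if "k < ?n" for k
    proof -
      have "mm ?n A H k 0 = mv ?n A v k" unfolding mm_def mv_def by (intro sum.cong) (auto simp: H0)
      then show ?thesis using ev[OF that] H0[OF that] by simp
    qed
    have "B i 0 = (\<Sum>k<?n. e * (H i k * H k 0))"
      unfolding B_def mm_def[of _ H] by (intro sum.cong refl) (simp add: AH mult.left_commute)
    also have "\<dots> = e * mm ?n H H i 0" unfolding mm_def sum_distrib_left by simp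
    finally show ?thesis using HH[OF i] by simp
  qed
  have B0': "B 0 i = cnj e * of_bool (i = 0)" if "i < ?n" for i
    using hermD[OF hB that, of 0] B0[OF that] by (cases "i = 0") simp_all
  have "herm n (\<lambda>i j. B (Suc i) (Suc j))" using hB unfolding herm_def by blast
  from Suc.IH[OF this] obtain a u where au: "spectral n (\<lambda>i j. B (Suc i) (Suc j)) a u" by blast
  define a' where "a' k = (case k of 0 \<Rightarrow> Re e | Suc k \<Rightarrow> a k)" for k
  define u' where "u' k i = (case k of 0 \<Rightarrow> of_bool (i = 0) | Suc k \<Rightarrow> (case i of 0 \<Rightarrow> 0 | Suc i \<Rightarrow> u k i))"
    for k i
  \<comment> \<open>The corner entry of \<open>B\<close> is read once as part of the first column
    and once as part of the first row, so the eigenvalue is real.\<close>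
  have e: "cnj e = e" using B0[of 0] B0'[of 0] by simp
  then have e': "of_real (Re e) = e" by (metis Reals_cnj_iff of_real_Re)
  have onb': "onb ?n u'"
  proof -
    have "ip ?n (u' k) (u' l) = of_bool (k = l)" if "k < ?n" "l < ?n" for k l
      using that au unfolding ip_def sum.lessThan_Suc_shift
      by (cases k; cases l) (auto simp: u'_def spectral_def onb_def ip_def)
    moreover have "(\<Sum>k<?n. u' k i * cnj (u' k j)) = of_bool (i = j)" if "i < ?n" "j < ?n" for i j
      using that au unfolding sum.lessThan_Suc_shift
      by (cases i; cases j) (auto simp: u'_def spectral_def onb_def)
    ultimately show ?thesis by (auto simp: onb_def)
  qed
  have Bspec: "B i j = spec ?n a' u' i j" if "i < ?n" "j < ?n" for i j
  proof (cases "i = 0 \<or> j = 0")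
    case True
    then show ?thesis using that B0[of i] B0'[of j] unfolding spec_def sum.lessThan_Suc_shift
      by (cases i; cases j) (auto simp: a'_def u'_def e e')
  next
    case False
    then obtain i' j' where "i = Suc i'" "j = Suc j'" by (cases i; cases j) auto
    then show ?thesis using that au unfolding spec_def sum.lessThan_Suc_shift
      by (auto simp: a'_def u'_def spectral_def spec_def)
  qed
  define U where "U k = mv ?n H (u' k)" for k
  have HHv: "mv ?n H (mv ?n H y) i = y i" if "i < ?n" for y i
  proof -
    have "mv ?n H (mv ?n H y) i = (\<Sum>j<?n. of_bool (i = j) * y j)"
      unfolding mv_mm[symmetric] mv_def[of _ "mm _ _ _"] using HH that by (intro sum.cong) auto
    then show ?thesis using that unfolding sum_of_bool_mult by simp
  qed
  \<comment> \<open>Used twice: constant coefficients 1 give completeness of \<open>U\<close>, the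
    coefficients \<open>a'\<close> give the decomposition of \<open>A\<close>.\<close>
  have conj: "(\<Sum>k<?n. c k * U k i * cnj (U k j)) = (\<Sum>x<?n. \<Sum>y<?n. H i x * H y j * (\<Sum>k<?n. c k * u' k x * cnj (u' k y)))"
    if "i < ?n" "j < ?n" for i j and c :: "nat \<Rightarrow> complex"
  proof -
    have "(\<Sum>k<?n. c k * U k i * cnj (U k j)) = (\<Sum>k<?n. \<Sum>x<?n. \<Sum>y<?n. c k * (H i x * u' k x) * (cnj (H j y) * cnj (u' k y)))"
      by (simp only: U_def mv_def sum_distrib_left sum_distrib_right cnj_sum complex_cnj_mult)
         (intro sum.cong refl sum.swap)
    also have "\<dots> = (\<Sum>k<?n. \<Sum>x<?n. \<Sum>y<?n. c k * (H i x * u' k x) * (H y j * cnj (u' k y)))"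
      using that by (intro sum.cong refl) (simp add: hermD[OF H])
    also have "\<dots> = (\<Sum>x<?n. \<Sum>k<?n. \<Sum>y<?n. c k * (H i x * u' k x) * (H y j * cnj (u' k y)))"
      by (rule sum.swap)
    also have "\<dots> = (\<Sum>x<?n. \<Sum>y<?n. \<Sum>k<?n. c k * (H i x * u' k x) * (H y j * cnj (u' k y)))"
      by (intro sum.cong refl sum.swap)
    finally show ?thesis by (simp only: sum_distrib_left mult_ac)
  qed
  have "spectral ?n A a' U"
    unfolding spectral_def
  proof (intro conjI allI impI)
    show "onb ?n U"
      unfolding onb_def
    proof (intro conjI allI impI)
      fix k l assume kl: "k < ?n" "l < ?n"
      have "ip ?n (U k) (U l) = ip ?n (u' k) (u' l)"
        unfolding U_def herm_ip[OF H] unfolding ip_def using HHv by (intro sum.cong) auto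
      then show "ip ?n (U k) (U l) = of_bool (k = l)" using onb' kl by (auto simp: onb_def)
    next
      fix i j assume ij: "i < ?n" "j < ?n"
      have "(\<Sum>k<?n. U k i * cnj (U k j)) = (\<Sum>x<?n. \<Sum>y<?n. H i x * H y j * of_bool (x = y))"
        using conj[OF ij, of "\<lambda>_. 1"] onb' unfolding onb_def by simp
      also have "\<dots> = mm ?n H H i j"
        unfolding mm_def sum_of_bool_mult by (intro sum.cong) auto
      finally show "(\<Sum>k<?n. U k i * cnj (U k j)) = of_bool (i = j)" using HH[OF ij] by simp
    qed
    fix i j assume ij: "i < ?n" "j < ?n"
    have "spec ?n a' U i j = (\<Sum>x<?n. \<Sum>y<?n. H i x * H y j * B x y)"
      unfolding spec_def[of _ _ U] conj[OF ij] using Bspec unfolding spec_def by (intro sum.cong refl) auto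
    also have "\<dots> = mm ?n H (mm ?n B H) i j"
      by (simp only: mm_def sum_distrib_left mult_ac)
    also have "\<dots> = mm ?n (mm ?n H H) (mm ?n A (mm ?n H H)) i j"
      unfolding B_def mm_assoc ..
    also have "\<dots> = (\<Sum>k<?n. of_bool (i = k) * (\<Sum>l<?n. A k l * of_bool (l = j)))"
      unfolding mm_def[of _ "mm _ _ _"] mm_def[of _ A] using HH ij by (intro sum.cong refl arg_cong2[of _ _ _ _ "(*)"]) auto
    also have "\<dots> = A i j" using ij unfolding sum_of_bool_mult by simp
    finally show "A i j = spec ?n a' U i j" ..
  qed
  then show ?case by blast
qed

section \<open>Relative entropy\<close>

text \<open>The squared overlaps of two bases. They form a doubly stochastic matrix
  (\<open>sum_wt\<close>), through which quantum relative entropy becomes a weighted sum of scalar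
  terms.\<close>

definition wt :: "nat \<Rightarrow> (nat \<Rightarrow> nat \<Rightarrow> complex) \<Rightarrow> (nat \<Rightarrow> nat \<Rightarrow> complex) \<Rightarrow> nat \<Rightarrow> nat \<Rightarrow> real" where
  "wt d u v k l = (cmod (ip d (u k) (v l)))\<^sup>2"

text \<open>
  The relative entropy \<open>tr A (ln A - ln B)\<close> of matrices with eigenvalues \<open>a\<close>, \<open>b\<close> and orthonormal
  eigenvectors \<open>u\<close>, \<open>v\<close>.
\<close>

definition relent ::
  "nat \<Rightarrow> (nat \<Rightarrow> real) \<Rightarrow> (nat \<Rightarrow> nat \<Rightarrow> complex) \<Rightarrow> (nat \<Rightarrow> real) \<Rightarrow> (nat \<Rightarrow> nat \<Rightarrow> complex) \<Rightarrow> real" where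
  "relent d a u b v = (\<Sum>k<d. \<Sum>l<d. wt d u v k l * (a k * (ln (a k) - ln (b l))))"

section \<open>Expansions of forms and traces in eigenbases\<close>

lemma wt_nonneg [simp]: "0 \<le> wt d u v k l"
  by (simp add: wt_def)

lemma ip_mult_ip: "ip d x y * ip d y x = of_real ((cmod (ip d x y))\<^sup>2)"
  by (metis complex_norm_square ip_cnj)

lemma ip_cong: "(\<And>i. i < d \<Longrightarrow> x i = x' i) \<Longrightarrow> (\<And>i. i < d \<Longrightarrow> y i = y' i) \<Longrightarrow> ip d x y = ip d x' y'"
  unfolding ip_def by (intro sum.cong) auto

lemma mv_cong: "(\<And>j. j < d \<Longrightarrow> A i j = A' i j) \<Longrightarrow> mv d A y i = mv d A' y i"
  unfolding mv_def by (intro sum.cong) auto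

lemma parseval:
  assumes "onb d v"
  shows "(\<Sum>l<d. ip d x (v l) * ip d (v l) y) = ip d x y"
proof -
  have "(\<Sum>l<d. ip d x (v l) * ip d (v l) y) = (\<Sum>l<d. \<Sum>j<d. \<Sum>i<d. cnj (x i) * v l i * (cnj (v l j) * y j))"
    by (simp only: ip_def sum_distrib_left sum_distrib_right)
  also have "\<dots> = (\<Sum>j<d. \<Sum>l<d. \<Sum>i<d. cnj (x i) * v l i * (cnj (v l j) * y j))"
    by (rule sum.swap)
  also have "\<dots> = (\<Sum>j<d. \<Sum>i<d. \<Sum>l<d. cnj (x i) * v l i * (cnj (v l j) * y j))"
    by (intro sum.cong refl sum.swap)
  also have "\<dots> = (\<Sum>j<d. \<Sum>i<d. cnj (x i) * y j * (\<Sum>l<d. v l i * cnj (v l j)))"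
    by (simp only: sum_distrib_left mult_ac)
  also have "\<dots> = (\<Sum>j<d. \<Sum>i<d. (cnj (x i) * y j) * of_bool (i = j))"
    using assms by (intro sum.cong refl) (simp add: onb_def)
  also have "\<dots> = ip d x y"
    unfolding sum_of_bool_mult ip_def by (intro sum.cong) auto
  finally show ?thesis .
qed

lemma parseval_norm:
  assumes "onb d v"
  shows "(\<Sum>l<d. (cmod (ip d x (v l)))\<^sup>2) = Re (ip d x x)"
proof -
  have "of_real (\<Sum>l<d. (cmod (ip d x (v l)))\<^sup>2) = ip d x x"
    unfolding of_real_sum parseval[OF assms, of x x, symmetric] by (intro sum.cong refl) (simp add: ip_mult_ip)
  then show ?thesis by (metis Re_complex_of_real)
qed

lemma cmod_ip_commute: "cmod (ip d x y) = cmod (ip d y x)"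
  by (metis ip_cnj complex_mod_cnj)

lemma onb_norm: "onb d u \<Longrightarrow> k < d \<Longrightarrow> ip d (u k) (u k) = 1"
  by (simp add: onb_def)

lemma sum_wt:
  assumes "onb d u" "onb d v"
  shows "k < d \<Longrightarrow> (\<Sum>l<d. wt d u v k l) = 1" "l < d \<Longrightarrow> (\<Sum>k<d. wt d u v k l) = 1"
proof -
  show "(\<Sum>l<d. wt d u v k l) = 1" if "k < d"
    using assms that unfolding wt_def by (simp add: parseval_norm onb_norm)
  show "(\<Sum>k<d. wt d u v k l) = 1" if "l < d"
    using parseval_norm[OF assms(1), of "v l"] onb_norm[OF assms(2) that]
    unfolding wt_def cmod_ip_commute[of d "v l"] by simp
qed

lemma wt_self: "onb d u \<Longrightarrow> k < d \<Longrightarrow> l < d \<Longrightarrow> wt d u u k l = of_bool (k = l)"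
  by (simp add: wt_def onb_def)

lemma ip_mv_spec: "ip d x (mv d (spec d a u) y) = (\<Sum>k<d. of_real (a k) * (ip d x (u k) * ip d (u k) y))"
proof -
  have "ip d x (mv d (spec d a u) y) = (\<Sum>i<d. \<Sum>j<d. \<Sum>k<d. cnj (x i) * (of_real (a k) * u k i * cnj (u k j) * y j))"
    by (simp only: ip_def mv_def spec_def sum_distrib_left sum_distrib_right)
  also have "\<dots> = (\<Sum>i<d. \<Sum>k<d. \<Sum>j<d. cnj (x i) * (of_real (a k) * u k i * cnj (u k j) * y j))"
    by (intro sum.cong refl sum.swap)
  also have "\<dots> = (\<Sum>k<d. \<Sum>i<d. \<Sum>j<d. cnj (x i) * (of_real (a k) * u k i * cnj (u k j) * y j))"
    by (rule sum.swap)
  also have "\<dots> = (\<Sum>k<d. of_real (a k) * (ip d x (u k) * ip d (u k) y))"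
    unfolding ip_def sum_product by (simp only: sum_distrib_left mult_ac)
  finally show ?thesis .
qed

lemma form_spectral:
  assumes "spectral d A a u"
  shows "ip d x (mv d A y) = (\<Sum>k<d. of_real (a k) * (ip d x (u k) * ip d (u k) y))"
proof -
  have "ip d x (mv d A y) = ip d x (mv d (spec d a u) y)"
    using assms by (intro ip_cong refl mv_cong) (simp add: spectral_def)
  then show ?thesis by (simp only: ip_mv_spec)
qed

lemma form_spectral_self:
  assumes "spectral d A a u"
  shows "Re (ip d x (mv d A x)) = (\<Sum>k<d. a k * (cmod (ip d (u k) x))\<^sup>2)"
proof -
  have "ip d x (mv d A x) = of_real (\<Sum>k<d. a k * (cmod (ip d (u k) x))\<^sup>2)"
    unfolding form_spectral[OF assms] of_real_sum
    by (intro sum.cong refl) (simp only: ip_mult_ip cmod_ip_commute[of d x] of_real_mult)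
  then show ?thesis by (metis Re_complex_of_real)
qed

lemma spectral_value:
  assumes "spectral d A a u" "k < d"
  shows "Re (ip d (u k) (mv d A (u k))) = a k"
proof -
  have "Re (ip d (u k) (mv d A (u k))) = (\<Sum>l<d. a l * of_bool (l = k))"
    unfolding form_spectral_self[OF assms(1)] using assms
    by (intro sum.cong refl) (auto simp: spectral_def onb_def)
  then show ?thesis using assms(2) unfolding sum_of_bool_mult by simp
qed

lemma tr_spectral:
  assumes "spectral d A a u"
  shows "tr d E A = (\<Sum>k<d. of_real (a k) * ip d (u k) (mv d E (u k)))"
proof -
  have "tr d E A = (\<Sum>i<d. \<Sum>j<d. \<Sum>k<d. E i j * (of_real (a k) * u k j * cnj (u k i)))"
    using assms unfolding tr_def spectral_def
    by (intro sum.cong refl) (simp add: spec_def sum_distrib_left)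
  also have "\<dots> = (\<Sum>i<d. \<Sum>k<d. \<Sum>j<d. E i j * (of_real (a k) * u k j * cnj (u k i)))"
    by (intro sum.cong refl sum.swap)
  also have "\<dots> = (\<Sum>k<d. \<Sum>i<d. \<Sum>j<d. E i j * (of_real (a k) * u k j * cnj (u k i)))"
    by (rule sum.swap)
  also have "\<dots> = (\<Sum>k<d. of_real (a k) * ip d (u k) (mv d E (u k)))"
    unfolding ip_def mv_def by (simp only: sum_distrib_left mult_ac)
  finally show ?thesis .
qed

lemma spectral_trace:
  assumes "spectral d A a u"
  shows "(\<Sum>i<d. A i i) = of_real (\<Sum>k<d. a k)"
proof -
  have "(\<Sum>i<d. A i i) = tr d (\<lambda>i j. of_bool (i = j)) A"
    unfolding tr_def sum_of_bool_mult by (intro sum.cong) auto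
  also have "\<dots> = (\<Sum>k<d. of_real (a k) * ip d (u k) (u k))"
    unfolding tr_spectral[OF assms]
    by (intro sum.cong refl arg_cong2[of _ _ _ _ "(*)"] ip_cong) (simp add: mv_def)
  also have "\<dots> = of_real (\<Sum>k<d. a k)"
    using assms by (simp add: spectral_def onb_def)
  finally show ?thesis .
qed

lemma spectral_spec: "onb d u \<Longrightarrow> spectral d (spec d a u) a u"
  by (simp add: spectral_def)

text \<open>Separates a term that depends only on the eigenvalues of \<open>A\<close> from a cross
  term that is linear in \<open>A\<close>. The linearity is what \<open>relent_midpoint\<close>
  exploits.\<close>

lemma relent_eq:
  assumes A: "spectral d A a u" and v: "onb d v"
  shows "relent d a u b v = (\<Sum>k<d. a k * ln (a k)) - Re (tr d (spec d (\<lambda>l. ln (b l)) v) A)"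
proof -
  have u: "onb d u" using A by (simp add: spectral_def)
  have "Re (tr d (spec d (\<lambda>l. ln (b l)) v) A) = (\<Sum>k<d. a k * (\<Sum>l<d. ln (b l) * wt d u v k l))"
    unfolding tr_spectral[OF A] by (simp add: form_spectral_self[OF spectral_spec[OF v]] wt_def cmod_ip_commute)
  moreover have "(\<Sum>k<d. a k * ln (a k)) = (\<Sum>k<d. (a k * ln (a k)) * (\<Sum>l<d. wt d u v k l))"
    using sum_wt(1)[OF u v] by simp
  ultimately show ?thesis
    unfolding relent_def by (simp add: sum_distrib_left sum_subtractf[symmetric] algebra_simps)
qed

section \<open>Bounds on relative entropy and its behaviour under averaging\<close>

lemma relent_self:
  assumes "onb d u"
  shows "relent d a u a u = 0"
  unfolding relent_def using wt_self[OF assms] by (intro sum.neutral ballI) auto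

text \<open>The termwise form of Pinsker's inequality. With p and q the square roots of
  \<open>a\<close> and \<open>b\<close>, ln r \<le> r - 1 bounds the bracket on the right below by
  (p - q)^2. Since |a - b| = |p - q| (p + q), the arithmetic-geometric mean inequality and (p + q)^2
  \<le> 2 (a + b) finish. The parameter \<open>s\<close> is left free, to be chosen after
  summation.\<close>

lemma scalar_ineq:
  fixes a b c x s :: real
  assumes a: "a > 0" and b: "b > 0" and "c \<ge> 0" "x \<ge> 0" "s \<ge> 0"
  shows "s * (\<bar>a - b\<bar> * c * x) - s\<^sup>2 / 2 * (a + b) * x\<^sup>2 \<le> c\<^sup>2 * (a * (ln a - ln b) - a + b)"
proof -
  define p q where "p = sqrt a" and "q = sqrt b"
  have p: "p > 0" "a = p\<^sup>2" and q: "q > 0" "b = q\<^sup>2" using a b by (auto simp: p_def q_def)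
  have "ln (q / p) \<le> q / p - 1" using p q by (intro ln_le_minus_one) auto
  then have "ln p - ln q \<ge> 1 - q / p" using p q by (simp add: ln_div)
  then have "2 * p\<^sup>2 * (ln p - ln q) \<ge> 2 * p\<^sup>2 * (1 - q / p)" using p by (intro mult_left_mono) auto
  also have "2 * p\<^sup>2 * (1 - q / p) = 2 * p\<^sup>2 - 2 * p * q" using p by (simp add: field_simps power2_eq_square)
  finally have "a * (ln a - ln b) - a + b \<ge> (p - q)\<^sup>2"
    using p q by (simp add: ln_realpow power2_diff algebra_simps)
  then have 1: "c\<^sup>2 * (a * (ln a - ln b) - a + b) \<ge> c\<^sup>2 * (p - q)\<^sup>2"
    by (intro mult_left_mono) auto
  have "\<bar>a - b\<bar> = \<bar>p - q\<bar> * (p + q)"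
    using p q by (simp add: power2_eq_square square_diff_square_factored abs_mult)
  then have "2 * (s * (\<bar>a - b\<bar> * c * x)) = 2 * (\<bar>p - q\<bar> * c) * (s * x * (p + q))" by (simp add: algebra_simps)
  also have "\<dots> \<le> 2 * (\<bar>p - q\<bar> * c)\<^sup>2 + (s * x * (p + q))\<^sup>2 / 2"
    using sum_squares_bound[of "2 * (\<bar>p - q\<bar> * c)" "s * x * (p + q)"] by (simp add: power_mult_distrib)
  also have "(p + q)\<^sup>2 \<le> 2 * (a + b)"
    using p q sum_squares_bound[of p q] by (simp add: power2_sum)
  then have "(s * x * (p + q))\<^sup>2 / 2 \<le> (s * x)\<^sup>2 * (2 * (a + b)) / 2"
    unfolding power_mult_distrib[of "s * x"] by (intro divide_right_mono mult_left_mono) auto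
  finally show ?thesis using 1 by (simp add: power_mult_distrib algebra_simps add_divide_distrib)
qed

text \<open>Pinsker's inequality with constant 1/4, tested on a Hermitian contraction. Expanding
  both traces in the two eigenbases turns their difference into a sum of
  \<open>(a k - b l) * (C k l * X k l)\<close>, to which \<open>scalar_ineq\<close> applies term by
  term. Because \<open>E\<close> is a contraction, the rows and columns of the matrix of |X|^2 sum
  to at most 1.\<close>

lemma relent_ge:
  assumes A: "spectral d A a u" and B: "spectral d B b v"
    and a: "\<And>k. k < d \<Longrightarrow> a k > 0" and b: "\<And>k. k < d \<Longrightarrow> b k > 0"
    and a1: "(\<Sum>k<d. a k) = 1" and b1: "(\<Sum>k<d. b k) = 1"
    and E: "herm d E" and E1: "\<And>x. Re (ip d (mv d E x) (mv d E x)) \<le> Re (ip d x x)"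
  shows "(Re (tr d E A) - Re (tr d E B))\<^sup>2 / 4 \<le> relent d a u b v"
proof -
  have u: "onb d u" and v: "onb d v" using A B by (auto simp: spectral_def)
  define X where "X k l = ip d (v l) (mv d E (u k))" for k l
  define C where "C k l = ip d (u k) (v l)" for k l
  have trA: "tr d E A = (\<Sum>k<d. \<Sum>l<d. of_real (a k) * (C k l * X k l))"
    unfolding tr_spectral[OF A] sum_distrib_left[symmetric] X_def C_def parseval[OF v] ..
  have "ip d (v l) (mv d E (v l)) = (\<Sum>k<d. C k l * X k l)" for l
    unfolding X_def C_def herm_ip[OF E, symmetric] parseval[OF u, symmetric, of "mv d E (v l)" "v l"]
    by (simp only: mult_ac)
  then have "tr d E B = (\<Sum>l<d. \<Sum>k<d. of_real (b l) * (C k l * X k l))"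
    unfolding tr_spectral[OF B] by (simp add: sum_distrib_left)
  also have "\<dots> = (\<Sum>k<d. \<Sum>l<d. of_real (b l) * (C k l * X k l))"
    by (rule sum.swap)
  finally have trB: "tr d E B = (\<Sum>k<d. \<Sum>l<d. of_real (b l) * (C k l * X k l))" .
  have X1: "(\<Sum>l<d. (cmod (X k l))\<^sup>2) \<le> 1" if "k < d" for k
  proof -
    have "(\<Sum>l<d. (cmod (X k l))\<^sup>2) = Re (ip d (mv d E (u k)) (mv d E (u k)))"
      unfolding X_def using parseval_norm[OF v, of "mv d E (u k)"] by (simp add: cmod_ip_commute)
    also have "\<dots> \<le> 1" using E1[of "u k"] onb_norm[OF u that] by simp
    finally show ?thesis .
  qed
  have X2: "(\<Sum>k<d. (cmod (X k l))\<^sup>2) \<le> 1" if "l < d" for l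
  proof -
    have "(\<Sum>k<d. (cmod (X k l))\<^sup>2) = Re (ip d (mv d E (v l)) (mv d E (v l)))"
      unfolding parseval_norm[OF u, symmetric] by (simp add: X_def herm_ip[OF E])
    also have "\<dots> \<le> 1" using E1[of "v l"] onb_norm[OF v that] by simp
    finally show ?thesis .
  qed
  define t where "t = \<bar>Re (tr d E A) - Re (tr d E B)\<bar>"
  \<comment> \<open>This choice maximises s t - s^2, with value t^2 / 4.\<close>
  define s where "s = t / 2"
  have s: "s \<ge> 0" by (simp add: s_def t_def)
  have "tr d E A - tr d E B = (\<Sum>k<d. \<Sum>l<d. of_real (a k - b l) * (C k l * X k l))"
    unfolding trA trB sum_subtractf[symmetric] by (simp add: algebra_simps)
  then have "t \<le> cmod (\<Sum>k<d. \<Sum>l<d. of_real (a k - b l) * (C k l * X k l))"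
    unfolding t_def by (metis abs_Re_le_cmod minus_complex.sel(1))
  also have "\<dots> \<le> (\<Sum>k<d. \<Sum>l<d. cmod (of_real (a k - b l) * (C k l * X k l)))"
    by (intro order.trans[OF norm_sum] sum_mono order.refl)
  also have "\<dots> = (\<Sum>k<d. \<Sum>l<d. \<bar>a k - b l\<bar> * cmod (C k l) * cmod (X k l))"
    by (simp only: norm_mult norm_of_real mult.assoc)
  finally have t: "t \<le> (\<Sum>k<d. \<Sum>l<d. \<bar>a k - b l\<bar> * cmod (C k l) * cmod (X k l))" .
  have "(\<Sum>k<d. \<Sum>l<d. (a k + b l) * (cmod (X k l))\<^sup>2)
      = (\<Sum>k<d. a k * (\<Sum>l<d. (cmod (X k l))\<^sup>2)) + (\<Sum>l<d. b l * (\<Sum>k<d. (cmod (X k l))\<^sup>2))"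
    by (simp only: distrib_right sum.distrib sum_distrib_left) (subst (3) sum.swap, simp)
  also have "\<dots> \<le> (\<Sum>k<d. a k * 1) + (\<Sum>l<d. b l * 1)"
    by (intro add_mono sum_mono mult_left_mono X1 X2) (auto simp: less_imp_le a b)
  finally have G: "(\<Sum>k<d. \<Sum>l<d. (a k + b l) * (cmod (X k l))\<^sup>2) \<le> 2" using a1 b1 by simp
  have "s * t - s\<^sup>2 / 2 * 2 \<le> s * (\<Sum>k<d. \<Sum>l<d. \<bar>a k - b l\<bar> * cmod (C k l) * cmod (X k l))
      - s\<^sup>2 / 2 * (\<Sum>k<d. \<Sum>l<d. (a k + b l) * (cmod (X k l))\<^sup>2)"
    using s t G by (intro diff_mono mult_left_mono) auto
  also have "\<dots> = (\<Sum>k<d. \<Sum>l<d. s * (\<bar>a k - b l\<bar> * cmod (C k l) * cmod (X k l))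
      - s\<^sup>2 / 2 * (a k + b l) * (cmod (X k l))\<^sup>2)"
    by (simp only: sum_distrib_left sum_subtractf mult.assoc)
  also have "\<dots> \<le> (\<Sum>k<d. \<Sum>l<d. (cmod (C k l))\<^sup>2 * (a k * (ln (a k) - ln (b l)) - a k + b l))"
    using s by (intro sum_mono scalar_ineq) (auto simp: a b)
  \<comment> \<open>The corrections \<open>- a k + b l\<close> cancel in total: the overlaps are
    doubly stochastic and both traces are 1.\<close>
  also have "\<dots> = relent d a u b v - (\<Sum>k<d. a k * (\<Sum>l<d. wt d u v k l)) + (\<Sum>l<d. b l * (\<Sum>k<d. wt d u v k l))"
    unfolding sum_distrib_left
    by (subst sum.swap[of "\<lambda>l k. b l * wt d u v k l"])
       (simp add: relent_def wt_def C_def sum_subtractf[symmetric] sum.distrib[symmetric] algebra_simps)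
  also have "\<dots> = relent d a u b v" using sum_wt[OF u v] a1 b1 by simp
  finally show ?thesis unfolding s_def by (simp add: t_def power2_eq_square field_simps)
qed

text \<open>Operator monotonicity of the logarithm is avoided. For each eigenvector of
  \<open>A\<close>, the domination A \<le> c B bounds \<open>a k\<close> times the form of the
  inverse of \<open>B\<close> at \<open>u k\<close> by \<open>c\<close>; averaging a tangent-line
  bound for the logarithm over the overlaps then suffices.\<close>

lemma relent_le:
  assumes A: "spectral d A a u" and B: "spectral d B b v"
    and a: "\<And>k. k < d \<Longrightarrow> a k > 0" and b: "\<And>k. k < d \<Longrightarrow> b k > 0"
    and a1: "(\<Sum>k<d. a k) = 1" and c: "c > 0"
    and le: "\<And>x. Re (ip d x (mv d A x)) \<le> c * Re (ip d x (mv d B x))"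
  shows "relent d a u b v \<le> ln c"
proof -
  have u: "onb d u" and v: "onb d v" using A B by (auto simp: spectral_def)
  have "(\<Sum>l<d. wt d u v k l * (a k * (ln (a k) - ln (b l)))) \<le> a k * ln c" if k: "k < d" for k
  proof -
    define T where "T = (\<Sum>l<d. wt d u v k l / b l)"
    have T0: "T \<ge> 0" unfolding T_def using b by (intro sum_nonneg) (simp add: less_imp_le)
    \<comment> \<open>\<open>z = B\<^sup>-\<^sup>1 u\<^sub>k\<close>; testing \<open>A \<le> c B\<close> on it gives \<open>a\<^sub>k T \<le> c\<close>.\<close>
    define z where "z i = (\<Sum>l<d. of_real (1 / b l) * v l i * ip d (v l) (u k))" for i
    have vz: "ip d (v m) z = of_real (1 / b m) * ip d (v m) (u k)" if m: "m < d" for m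
    proof -
      have "ip d (v m) z = (\<Sum>i<d. \<Sum>l<d. cnj (v m i) * (of_real (1 / b l) * v l i * ip d (v l) (u k)))"
        unfolding ip_def[of d "v m"] z_def sum_distrib_left ..
      also have "\<dots> = (\<Sum>l<d. \<Sum>i<d. cnj (v m i) * (of_real (1 / b l) * v l i * ip d (v l) (u k)))"
        by (rule sum.swap)
      also have "\<dots> = (\<Sum>l<d. ip d (v m) (v l) * (of_real (1 / b l) * ip d (v l) (u k)))"
        unfolding ip_def[of d "v m"] sum_distrib_right by (simp only: mult_ac)
      also have "\<dots> = (\<Sum>l<d. of_bool (m = l) * (of_real (1 / b l) * ip d (v l) (u k)))"
        using v m by (intro sum.cong refl) (simp add: onb_def)
      finally show ?thesis using m unfolding sum_of_bool_mult by simp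
    qed
    have "ip d (u k) z = of_real T"
    proof -
      have "ip d (u k) z = (\<Sum>l<d. ip d (u k) (v l) * ip d (v l) z)" by (rule parseval[OF v, symmetric])
      also have "\<dots> = (\<Sum>l<d. of_real (1 / b l) * (ip d (u k) (v l) * ip d (v l) (u k)))"
        by (intro sum.cong refl) (simp add: vz)
      also have "\<dots> = of_real T" unfolding ip_mult_ip T_def wt_def by simp
      finally show ?thesis .
    qed
    then have "a k * T\<^sup>2 = a k * (cmod (ip d (u k) z))\<^sup>2" by simp
    also have "\<dots> \<le> (\<Sum>k<d. a k * (cmod (ip d (u k) z))\<^sup>2)"
      using k a by (intro member_le_sum) (auto simp: less_imp_le)
    also have "\<dots> = Re (ip d z (mv d A z))" by (rule form_spectral_self[OF A, symmetric])
    also have "\<dots> \<le> c * Re (ip d z (mv d B z))" by (rule le)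
    also have "Re (ip d z (mv d B z)) = (\<Sum>l<d. b l * (cmod (ip d (v l) z))\<^sup>2)" by (rule form_spectral_self[OF B])
    also have "\<dots> = (\<Sum>l<d. wt d u v k l / b l)"
    proof (intro sum.cong refl)
      fix l assume "l \<in> {..<d}"
      then have "l < d" "b l > 0" using b by auto
      then show "b l * (cmod (ip d (v l) z))\<^sup>2 = wt d u v k l / b l"
        by (simp add: vz wt_def norm_mult norm_divide power_divide cmod_ip_commute[of d "v l"] power2_eq_square)
    qed
    finally have "a k * T * T \<le> c * T" by (simp add: T_def[symmetric] power2_eq_square mult.assoc)
    then have aT: "a k * T \<le> c" using T0 c by (cases "T = 0") auto
    have "(\<Sum>l<d. wt d u v k l * (ln (a k) - ln (b l))) \<le> (\<Sum>l<d. wt d u v k l * (ln c + (a k / (c * b l) - 1)))"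
    proof (intro sum_mono mult_left_mono)
      fix l assume "l \<in> {..<d}"
      then have bl: "b l > 0" using b by auto
      \<comment> \<open>The ratio is scaled by \<open>c\<close> so that, after averaging, the linear
        remainder is \<open>a k * T / c - 1\<close>, which is at most 0.\<close>
      have "ln (a k / (c * b l)) \<le> a k / (c * b l) - 1" using a[OF k] bl c by (intro ln_le_minus_one) auto
      then show "ln (a k) - ln (b l) \<le> ln c + (a k / (c * b l) - 1)"
        using a[OF k] bl c by (simp add: ln_div ln_mult)
    qed auto
    also have "\<dots> = (ln c - 1) * (\<Sum>l<d. wt d u v k l) + (a k / c) * T"
      unfolding T_def sum_distrib_left sum.distrib[symmetric] by (intro sum.cong refl) (simp add: algebra_simps)
    also have "\<dots> \<le> ln c" using aT c sum_wt(1)[OF u v k] by (simp add: field_simps)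
    finally have "a k * (\<Sum>l<d. wt d u v k l * (ln (a k) - ln (b l))) \<le> a k * ln c"
      using a[OF k] by (intro mult_left_mono) auto
    then show ?thesis by (simp add: sum_distrib_left mult.left_commute)
  qed
  then have "relent d a u b v \<le> (\<Sum>k<d. a k * ln c)" unfolding relent_def by (intro sum_mono) auto
  then show ?thesis using a1 by (simp add: sum_distrib_right[symmetric])
qed

text \<open>Donald's identity for two equally weighted states. The cross terms are linear in the
  first argument, so only entropies of the two states and of their mean remain. The subtracted
  average is the Holevo information of the pair.\<close>

lemma relent_midpoint:
  assumes A0: "spectral d A0 a0 u0" and A1: "spectral d A1 a1 u1" and A: "spectral d A a u"
    and v: "onb d v"
    and mid: "\<And>i j. i < d \<Longrightarrow> j < d \<Longrightarrow> A i j = (A0 i j + A1 i j) / 2"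
  shows "relent d a u b v = (relent d a0 u0 b v + relent d a1 u1 b v) / 2
     - (relent d a0 u0 a u + relent d a1 u1 a u) / 2"
proof -
  have u: "onb d u" using A by (simp add: spectral_def)
  have lin: "tr d L A = (tr d L A0 + tr d L A1) / 2" for L
    unfolding tr_def add_divide_distrib sum_divide_distrib sum.distrib[symmetric]
    by (intro sum.cong refl) (simp add: mid algebra_simps add_divide_distrib)
  show ?thesis
    \<comment> \<open>Identifies the entropy term of \<open>A\<close> with the cross term of
      \<open>A\<close> against its own logarithm.\<close>
    using relent_self[OF u, of a]
    unfolding relent_eq[OF A0 v] relent_eq[OF A1 v] relent_eq[OF A v]
      relent_eq[OF A0 u] relent_eq[OF A1 u] relent_eq[OF A u] lin
    by (simp add: field_simps)
qed

section \<open>States on a tensor product\<close>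

definition pos :: "nat \<Rightarrow> (nat \<Rightarrow> nat \<Rightarrow> complex) \<Rightarrow> bool" where
  "pos d A \<longleftrightarrow> (\<forall>x. 0 \<le> ip d x (mv d A x))"

text \<open>Polarisation: the form is real at e_i + c e_j, and the values 0, 1, -1, \<i>, -\<i> of c
  determine the relation between the two entries.\<close>

lemma pos_herm:
  assumes "pos d A"
  shows "herm d A"
  unfolding herm_def
proof (intro allI impI)
  fix i j assume ij: "i < d" "j < d"
  have form: "ip d x (mv d A x) = A i i + c * A i j + cnj c * (A j i + c * A j j)"
    if x: "x = (\<lambda>k. of_bool (k = i) + c * of_bool (k = j))" for c x
  proof -
    have *: "mv d A x p = A p i + c * A p j" for p
      unfolding mv_def x distrib_left mult.left_commute[of _ c] sum.distrib sum_distrib_left[symmetric]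
        sum_of_bool_mult using ij by simp
    have "ip d x (mv d A x) = (\<Sum>p<d. of_bool (p = i) * mv d A x p) + cnj c * (\<Sum>p<d. of_bool (p = j) * mv d A x p)"
      unfolding ip_def sum_distrib_left sum.distrib[symmetric] by (intro sum.cong refl) (simp add: x algebra_simps)
    then show ?thesis unfolding sum_of_bool_mult using ij by (simp add: *)
  qed
  have Im0: "Im (A i i + c * A i j + cnj c * (A j i + c * A j j)) = 0" for c
    using assms unfolding pos_def form[OF refl, symmetric] by (auto simp: less_eq_complex_def)
  show "A i j = cnj (A j i)"
    using Im0[of 0] Im0[of 1] Im0[of "-1"] Im0[of \<i>] Im0[of "-\<i>"] by (simp add: complex_eq_iff)
qed

lemma psd_pos:
  assumes "psd d M"
  shows "pos d (\<lambda>i j. M $$ (i, j))"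
  unfolding pos_def
proof
  fix x
  have "0 \<le> (M *\<^sub>v vec d x) \<bullet>c vec d x" using assms by (auto simp: psd_def)
  also have "\<dots> = ip d x (mv d (\<lambda>i j. M $$ (i, j)) x)"
    using assms by (auto simp: psd_def ip_def mv_def scalar_prod_def lessThan_atLeast0 mult.commute intro!: sum.cong)
  finally show "0 \<le> ip d x (mv d (\<lambda>i j. M $$ (i, j)) x)" .
qed

text \<open>The eigenvalues lie between 0 and 1, hence so do their squares. This puts measurement
  operators into the form that \<open>relent_ge\<close> requires.\<close>

lemma effect_contraction:
  assumes E: "herm d E"
    and E0: "\<And>x. 0 \<le> Re (ip d x (mv d E x))" and E1: "\<And>x. Re (ip d x (mv d E x)) \<le> Re (ip d x x)"
  shows "Re (ip d (mv d E x) (mv d E x)) \<le> Re (ip d x x)"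
proof -
  obtain a u where A: "spectral d E a u" using spectral_theorem[OF E] by blast
  then have u: "onb d u" by (simp add: spectral_def)
  have "Re (ip d (mv d E x) (mv d E x)) = (\<Sum>k<d. (cmod (ip d (mv d E x) (u k)))\<^sup>2)"
    by (rule parseval_norm[OF u, symmetric])
  also have "\<dots> \<le> (\<Sum>k<d. (cmod (ip d x (u k)))\<^sup>2)"
  proof (intro sum_mono)
    fix k assume "k \<in> {..<d}"
    then have k: "k < d" by simp
    have a: "0 \<le> a k" "a k \<le> 1"
      using E0[of "u k"] E1[of "u k"] spectral_value[OF A k] onb_norm[OF u k] by auto
    have "ip d (mv d E x) (u k) = (\<Sum>l<d. (of_real (a l) * ip d x (u l)) * of_bool (l = k))"
      unfolding herm_ip[OF E] form_spectral[OF A]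
      by (intro sum.cong refl) (use u k in \<open>simp add: onb_def\<close>)
    then have "ip d (mv d E x) (u k) = of_real (a k) * ip d x (u k)"
      using k unfolding sum_of_bool_mult by simp
    then have "(cmod (ip d (mv d E x) (u k)))\<^sup>2 = (a k)\<^sup>2 * (cmod (ip d x (u k)))\<^sup>2"
      by (simp add: norm_mult power_mult_distrib)
    also have "\<dots> \<le> 1 * (cmod (ip d x (u k)))\<^sup>2"
      using a by (intro mult_right_mono) (auto simp: power_le_one)
    finally show "(cmod (ip d (mv d E x) (u k)))\<^sup>2 \<le> (cmod (ip d x (u k)))\<^sup>2" by simp
  qed
  also have "\<dots> = Re (ip d x x)" by (rule parseval_norm[OF u])
  finally show ?thesis .
qed

text \<open>The index \<open>p * e + s\<close> encodes the pair (p, s), as in \<open>kron\<close>.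
  Sums over a tensor product become double sums.\<close>

lemma sum_lessThan_mult:
  fixes f :: "nat \<Rightarrow> 'a :: comm_monoid_add"
  shows "(\<Sum>i<n * e. f i) = (\<Sum>p<n. \<Sum>s<e. f (p * e + s))"
proof (induction n)
  case (Suc n)
  have "(\<Sum>i<Suc n * e. f i) = (\<Sum>i<n * e. f i) + (\<Sum>i=n * e..<n * e + e. f i)"
    by (simp add: sum.atLeastLessThan_concat lessThan_atLeast0 add.commute)
  also have "(\<Sum>i=n * e..<n * e + e. f i) = (\<Sum>s<e. f (n * e + s))"
    using sum.shift_bounds_nat_ivl[of f 0 "n * e" e] by (simp add: lessThan_atLeast0 add.commute)
  finally show ?case using Suc.IH by simp
qed simp

text \<open>A completely positive map in entries: the sum of \<open>G n\<close>, \<open>R\<close>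
  and the adjoint of \<open>G n\<close> multiplied in this order.\<close>

definition conj_sum ::
  "nat \<Rightarrow> nat \<Rightarrow> (nat \<Rightarrow> nat \<Rightarrow> nat \<Rightarrow> complex) \<Rightarrow> (nat \<Rightarrow> nat \<Rightarrow> complex) \<Rightarrow> nat \<Rightarrow> nat \<Rightarrow> complex" where
  "conj_sum N d G R i j = (\<Sum>n<N. \<Sum>k<d. \<Sum>l<d. G n i k * R k l * cnj (G n j l))"

text \<open>The form at \<open>x\<close> is the sum of the forms of \<open>R\<close> at the vectors
  \<open>y n\<close>, the images of \<open>x\<close> under the adjoints of the
  \<open>G n\<close>.\<close>

lemma pos_conj_sum:
  assumes "pos d R"
  shows "pos d' (conj_sum N d G R)"
  unfolding pos_def
proof
  fix x
  define y where "y n k = (\<Sum>i<d'. cnj (G n i k) * x i)" for n k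
  have "ip d' x (mv d' (conj_sum N d G R) x)
      = (\<Sum>i<d'. \<Sum>j<d'. \<Sum>n<N. \<Sum>k<d. \<Sum>l<d. cnj (x i) * (G n i k * R k l * cnj (G n j l) * x j))"
    by (simp only: ip_def mv_def conj_sum_def sum_distrib_left sum_distrib_right)
  also have "\<dots> = (\<Sum>i<d'. \<Sum>n<N. \<Sum>j<d'. \<Sum>k<d. \<Sum>l<d. cnj (x i) * (G n i k * R k l * cnj (G n j l) * x j))"
    by (intro sum.cong refl sum.swap)
  also have "\<dots> = (\<Sum>n<N. \<Sum>i<d'. \<Sum>j<d'. \<Sum>k<d. \<Sum>l<d. cnj (x i) * (G n i k * R k l * cnj (G n j l) * x j))"
    by (rule sum.swap)
  also have "\<dots> = (\<Sum>n<N. ip d (y n) (mv d R (y n)))"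
  proof (intro sum.cong refl)
    fix n
    let ?t = "\<lambda>i j k l. cnj (x i) * (G n i k * R k l * cnj (G n j l) * x j)"
    have "(\<Sum>i<d'. \<Sum>j<d'. \<Sum>k<d. \<Sum>l<d. ?t i j k l) = (\<Sum>i<d'. \<Sum>k<d. \<Sum>j<d'. \<Sum>l<d. ?t i j k l)"
      by (intro sum.cong refl sum.swap)
    also have "\<dots> = (\<Sum>k<d. \<Sum>i<d'. \<Sum>j<d'. \<Sum>l<d. ?t i j k l)"
      by (rule sum.swap)
    also have "\<dots> = (\<Sum>k<d. \<Sum>i<d'. \<Sum>l<d. \<Sum>j<d'. ?t i j k l)"
      by (intro sum.cong refl sum.swap)
    also have "\<dots> = (\<Sum>k<d. \<Sum>i<d'. \<Sum>l<d. (cnj (x i) * G n i k) * (R k l * y n l))"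
      unfolding y_def sum_distrib_left by (simp only: mult_ac)
    also have "\<dots> = (\<Sum>k<d. cnj (y n k) * mv d R (y n) k)"
      unfolding mv_def sum_distrib_left[symmetric] sum_distrib_right[symmetric]
      by (simp add: y_def mult.commute)
    finally show "(\<Sum>i<d'. \<Sum>j<d'. \<Sum>k<d. \<Sum>l<d. ?t i j k l) = ip d (y n) (mv d R (y n))"
      by (simp add: ip_def)
  qed
  also have "\<dots> \<ge> 0" using assms by (intro sum_nonneg) (simp add: pos_def)
  finally show "0 \<le> ip d' x (mv d' (conj_sum N d G R) x)" .
qed

text \<open>The partial trace over the first factor, of dimension \<open>n\<close>.\<close>

definition marginal :: "nat \<Rightarrow> nat \<Rightarrow> (nat \<Rightarrow> nat \<Rightarrow> complex) \<Rightarrow> nat \<Rightarrow> nat \<Rightarrow> complex" where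
  "marginal n e A s t = (\<Sum>p<n. A (p * e + s) (p * e + t))"

text \<open>The operator \<open>I \<otimes> B\<close>, where \<open>B\<close> acts on the second tensor factor, of dimension \<open>e\<close>.\<close>

definition ampl :: "nat \<Rightarrow> (nat \<Rightarrow> nat \<Rightarrow> complex) \<Rightarrow> nat \<Rightarrow> nat \<Rightarrow> complex" where
  "ampl e B i j = of_bool (i div e = j div e) * B (i mod e) (j mod e)"

lemma ampl_form:
  "ip (n * e) x (mv (n * e) (ampl e B) x) =
    (\<Sum>p<n. \<Sum>s<e. \<Sum>t<e. cnj (x (p * e + s)) * B s t * x (p * e + t))"
proof -
  have "mv (n * e) (ampl e B) x (p * e + s) = (\<Sum>t<e. B s t * x (p * e + t))" if ps: "p < n" "s < e" for p s
  proof -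
    have "mv (n * e) (ampl e B) x (p * e + s) = (\<Sum>r<n. of_bool (r = p) * (\<Sum>t<e. B s t * x (r * e + t)))"
      unfolding mv_def sum_lessThan_mult sum_distrib_left
      by (intro sum.cong refl) (use ps in \<open>auto simp: ampl_def\<close>)
    then show ?thesis using ps unfolding sum_of_bool_mult by simp
  qed
  then show ?thesis
    unfolding ip_def sum_lessThan_mult by (simp add: sum_distrib_left mult.assoc)
qed

lemma cmod_sum_squared_le: "(cmod (\<Sum>p<n. z p))\<^sup>2 \<le> real n * (\<Sum>p<n. (cmod (z p))\<^sup>2)"
proof -
  have "(cmod (\<Sum>p<n. z p))\<^sup>2 \<le> (\<Sum>p<n. cmod (z p))\<^sup>2"
    by (intro power_mono norm_sum) auto
  also have "\<dots> = (\<Sum>p<n. \<Sum>r<n. cmod (z p) * cmod (z r))"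
    by (simp add: power2_eq_square sum_product)
  also have "\<dots> \<le> (\<Sum>p<n. \<Sum>r<n. ((cmod (z p))\<^sup>2 + (cmod (z r))\<^sup>2) / 2)"
  proof (intro sum_mono)
    fix p r
    show "cmod (z p) * cmod (z r) \<le> ((cmod (z p))\<^sup>2 + (cmod (z r))\<^sup>2) / 2"
      using sum_squares_bound[of "cmod (z p)" "cmod (z r)"] by simp
  qed
  also have "\<dots> = real n * (\<Sum>p<n. (cmod (z p))\<^sup>2)"
    by (simp add: add_divide_distrib sum.distrib sum_divide_distrib[symmetric] sum_distrib_left[symmetric])
  finally show ?thesis .
qed

text \<open>Cutting \<open>x\<close> into its \<open>n\<close> blocks costs a factor
  \<open>n\<close> by Cauchy-Schwarz in the eigenbasis of \<open>T\<close>. The form of the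
  amplified marginal is the sum of the forms of \<open>T\<close> at all \<open>y p r\<close>; the
  blocks in their own positions are the summands with p = r, and the others are nonnegative.\<close>

lemma pos_le_ampl_marginal:
  assumes T: "pos (n * e) T"
  shows "Re (ip (n * e) x (mv (n * e) T x)) \<le> real n * Re (ip (n * e) x (mv (n * e) (ampl e (marginal n e T)) x))"
    and "0 \<le> ip (n * e) x (mv (n * e) (ampl e (marginal n e T)) x)"
proof -
  \<comment> \<open>\<open>y p r\<close> is the \<open>p\<close>-th block of \<open>x\<close>, moved to position \<open>r\<close>.\<close>
  define y where "y p r i = of_bool (i div e = r) * x (p * e + i mod e)" for p r i
  let ?q = "\<lambda>z. ip (n * e) z (mv (n * e) T z)"
  have q0: "0 \<le> ?q z" for z using T by (simp add: pos_def)
  have yform: "?q (y p r) = (\<Sum>s<e. \<Sum>t<e. cnj (x (p * e + s)) * T (r * e + s) (r * e + t) * x (p * e + t))"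
    if r: "r < n" for p r
  proof -
    have mvy: "mv (n * e) T (y p r) i = (\<Sum>t<e. T i (r * e + t) * x (p * e + t))" for i
    proof -
      have "mv (n * e) T (y p r) i = (\<Sum>r'<n. of_bool (r' = r) * (\<Sum>t<e. T i (r' * e + t) * x (p * e + t)))"
        unfolding mv_def sum_lessThan_mult sum_distrib_left
        by (intro sum.cong refl) (auto simp: y_def)
      then show ?thesis using r unfolding sum_of_bool_mult by simp
    qed
    have "?q (y p r) = (\<Sum>r'<n. of_bool (r' = r) * (\<Sum>s<e. cnj (x (p * e + s)) * mv (n * e) T (y p r) (r' * e + s)))"
      unfolding ip_def sum_lessThan_mult sum_distrib_left
      by (intro sum.cong refl) (auto simp: y_def)
    then show ?thesis using r unfolding sum_of_bool_mult mvy by (simp add: sum_distrib_left mult.assoc)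
  qed
  have total: "ip (n * e) x (mv (n * e) (ampl e (marginal n e T)) x) = (\<Sum>p<n. \<Sum>r<n. ?q (y p r))"
  proof -
    have "(\<Sum>r<n. ?q (y p r)) = (\<Sum>s<e. \<Sum>t<e. cnj (x (p * e + s)) * marginal n e T s t * x (p * e + t))" for p
    proof -
      have "(\<Sum>r<n. ?q (y p r)) = (\<Sum>r<n. \<Sum>s<e. \<Sum>t<e. cnj (x (p * e + s)) * T (r * e + s) (r * e + t) * x (p * e + t))"
        by (intro sum.cong refl) (simp add: yform)
      also have "\<dots> = (\<Sum>s<e. \<Sum>r<n. \<Sum>t<e. cnj (x (p * e + s)) * T (r * e + s) (r * e + t) * x (p * e + t))"
        by (rule sum.swap)
      also have "\<dots> = (\<Sum>s<e. \<Sum>t<e. \<Sum>r<n. cnj (x (p * e + s)) * T (r * e + s) (r * e + t) * x (p * e + t))"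
        by (intro sum.cong refl sum.swap)
      finally show ?thesis by (simp add: marginal_def sum_distrib_left sum_distrib_right)
    qed
    then show ?thesis unfolding ampl_form by simp
  qed
  show "0 \<le> ip (n * e) x (mv (n * e) (ampl e (marginal n e T)) x)"
    unfolding total using q0 by (intro sum_nonneg) auto
  obtain a u where A: "spectral (n * e) T a u" using spectral_theorem[OF pos_herm[OF T]] by blast
  have split: "ip (n * e) w x = (\<Sum>p<n. ip (n * e) w (y p p))" for w
  proof -
    have "(\<Sum>p<n. ip (n * e) w (y p p)) = (\<Sum>r<n. \<Sum>p<n. \<Sum>s<e. cnj (w (r * e + s)) * y p p (r * e + s))"
      unfolding ip_def sum_lessThan_mult by (rule sum.swap)
    also have "\<dots> = (\<Sum>r<n. \<Sum>p<n. of_bool (r = p) * (\<Sum>s<e. cnj (w (r * e + s)) * x (p * e + s)))"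
      unfolding sum_distrib_left by (intro sum.cong refl) (auto simp: y_def)
    also have "\<dots> = ip (n * e) w x"
      unfolding sum_of_bool_mult ip_def sum_lessThan_mult by (intro sum.cong) auto
    finally show ?thesis ..
  qed
  have "Re (?q x) = (\<Sum>k<n * e. a k * (cmod (\<Sum>p<n. ip (n * e) (u k) (y p p)))\<^sup>2)"
    unfolding form_spectral_self[OF A] split[symmetric] ..
  also have "\<dots> \<le> (\<Sum>k<n * e. a k * (real n * (\<Sum>p<n. (cmod (ip (n * e) (u k) (y p p)))\<^sup>2)))"
  proof (intro sum_mono mult_left_mono cmod_sum_squared_le)
    fix k assume "k \<in> {..<n * e}"
    then show "0 \<le> a k" using spectral_value[OF A, of k] q0[of "u k"] by (simp add: less_eq_complex_def)
  qed
  also have "\<dots> = real n * (\<Sum>k<n * e. \<Sum>p<n. a k * (cmod (ip (n * e) (u k) (y p p)))\<^sup>2)"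
    by (simp only: sum_distrib_left mult.left_commute)
  also have "\<dots> = real n * (\<Sum>p<n. Re (?q (y p p)))"
    unfolding form_spectral_self[OF A] by (subst sum.swap) simp
  also have "\<dots> \<le> real n * (\<Sum>p<n. \<Sum>r<n. Re (?q (y p r)))"
    using q0 by (intro mult_left_mono sum_mono member_le_sum) (auto simp: less_eq_complex_def)
  also have "\<dots> = real n * Re (ip (n * e) x (mv (n * e) (ampl e (marginal n e T)) x))"
    unfolding total by simp
  finally show "Re (?q x) \<le> real n * Re (ip (n * e) x (mv (n * e) (ampl e (marginal n e T)) x))" .
qed

section \<open>Kraus operators in entries, and no signalling\<close>

definition tensor_one :: "nat \<Rightarrow> complex mat \<Rightarrow> nat \<Rightarrow> nat \<Rightarrow> complex" where
  "tensor_one e K i k = K $$ (i div e, k div e) * of_bool (i mod e = k mod e)"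

lemma mat_adjoint_carrier: "(K :: complex mat) \<in> carrier_mat r c \<Longrightarrow> mat_adjoint K \<in> carrier_mat c r"
  by (auto simp: mat_adjoint_eq)

lemma mat_sum_entry:
  assumes "\<And>A. A \<in> set As \<Longrightarrow> A \<in> carrier_mat d d" and "i < d" "j < d"
  shows "mat_sum d As $$ (i, j) = (\<Sum>n<length As. (As ! n) $$ (i, j)) \<and> mat_sum d As \<in> carrier_mat d d"
  using assms(1)
proof (induction As)
  case Nil
  then show ?case using assms(2,3) by (simp add: mat_sum_def)
next
  case (Cons A As)
  have IH: "mat_sum d As $$ (i, j) = (\<Sum>n<length As. (As ! n) $$ (i, j))" "mat_sum d As \<in> carrier_mat d d"
    using Cons by auto
  have "mat_sum d (A # As) = A + mat_sum d As" by (simp add: mat_sum_def)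
  then show ?case using IH Cons.prems[of A] assms(2,3)
    by (simp add: sum.lessThan_Suc_shift del: sum.lessThan_Suc)
qed

lemma apply_first_carrier:
  assumes Ks: "set Ks \<subseteq> carrier_mat d' dA" and R: "R \<in> carrier_mat (dA * e) (dA * e)"
  shows "apply_first d' e Ks R \<in> carrier_mat (d' * e) (d' * e)"
  unfolding apply_first_def mat_sum_def using Ks
proof (induction Ks)
  case (Cons K Ks)
  then have "kron K (1\<^sub>m e) \<in> carrier_mat (d' * e) (dA * e)" by (auto simp: kron_def)
  then have "kron K (1\<^sub>m e) * R * mat_adjoint (kron K (1\<^sub>m e)) \<in> carrier_mat (d' * e) (d' * e)"
    by (intro mult_carrier_mat[OF mult_carrier_mat[OF _ R] mat_adjoint_carrier])
  then show ?case using Cons by simp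
qed simp

lemma apply_first_entry:
  assumes Ks: "set Ks \<subseteq> carrier_mat d' dA" and R: "R \<in> carrier_mat (dA * e) (dA * e)"
    and ij: "i < d' * e" "j < d' * e"
  shows "apply_first d' e Ks R $$ (i, j)
     = conj_sum (length Ks) (dA * e) (\<lambda>n. tensor_one e (Ks ! n)) (\<lambda>k l. R $$ (k, l)) i j"
proof -
  let ?G = "\<lambda>K. kron K (1\<^sub>m e)"
  have carr: "?G K \<in> carrier_mat (d' * e) (dA * e)" if "K \<in> set Ks" for K
    using that Ks by (auto simp: kron_def)
  have G: "?G K $$ (i, k) = tensor_one e K i k" if "K \<in> set Ks" "i < d' * e" "k < dA * e" for K i k
  proof -
    have "e > 0" using that by (cases e) auto
    then show ?thesis using that Ks by (auto simp: kron_def tensor_one_def)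
  qed
  have entry: "(?G K * R * mat_adjoint (?G K)) $$ (i, j)
      = (\<Sum>k<dA * e. \<Sum>l<dA * e. tensor_one e K i k * R $$ (k, l) * cnj (tensor_one e K j l))" if K: "K \<in> set Ks" for K
  proof -
    have "(?G K * R * mat_adjoint (?G K)) $$ (i, j)
      = (\<Sum>l<dA * e. (\<Sum>k<dA * e. ?G K $$ (i, k) * R $$ (k, l)) * cnj (?G K $$ (j, l)))"
      using carr[OF K] R ij by (simp add: mat_adjoint_eq scalar_prod_def lessThan_atLeast0)
    also have "\<dots> = (\<Sum>l<dA * e. \<Sum>k<dA * e. tensor_one e K i k * R $$ (k, l) * cnj (tensor_one e K j l))"
      unfolding sum_distrib_right using G[OF K] ij by (intro sum.cong refl) simp
    finally show ?thesis by (subst sum.swap) simp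
  qed
  have carr': "?G K * R * mat_adjoint (?G K) \<in> carrier_mat (d' * e) (d' * e)" if "K \<in> set Ks" for K
    using carr[OF that] by (intro mult_carrier_mat[OF mult_carrier_mat[OF _ R] mat_adjoint_carrier])
  have "apply_first d' e Ks R $$ (i, j)
    = (\<Sum>n<length Ks. (?G (Ks ! n) * R * mat_adjoint (?G (Ks ! n))) $$ (i, j))"
    unfolding apply_first_def
    using mat_sum_entry[OF _ ij, of "map (\<lambda>K. ?G K * R * mat_adjoint (?G K)) Ks"] carr'
    by auto
  also have "\<dots> = conj_sum (length Ks) (dA * e) (\<lambda>n. tensor_one e (Ks ! n)) (\<lambda>k l. R $$ (k, l)) i j"
    unfolding conj_sum_def by (intro sum.cong refl entry) auto
  finally show ?thesis .
qed

lemma kraus_complete: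
  assumes "quantum_op dA d' Ks" and r: "r < dA" "r' < dA"
  shows "(\<Sum>n<length Ks. \<Sum>p<d'. (Ks ! n) $$ (p, r) * cnj ((Ks ! n) $$ (p, r'))) = of_bool (r = r')"
proof -
  have Ks: "set Ks \<subseteq> carrier_mat d' dA" and one: "mat_sum dA (map (\<lambda>K. mat_adjoint K * K) Ks) = 1\<^sub>m dA"
    using assms(1) by (auto simp: quantum_op_def)
  have carr: "mat_adjoint K * K \<in> carrier_mat dA dA" if "K \<in> set Ks" for K
    using that Ks by (intro mult_carrier_mat mat_adjoint_carrier) auto
  have "of_bool (r = r') = mat_sum dA (map (\<lambda>K. mat_adjoint K * K) Ks) $$ (r', r)"
    unfolding one using r by auto
  also have "\<dots> = (\<Sum>n<length Ks. (mat_adjoint (Ks ! n) * Ks ! n) $$ (r', r))"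
    using mat_sum_entry[OF _ r(2) r(1), of "map (\<lambda>K. mat_adjoint K * K) Ks"] carr by auto
  also have "\<dots> = (\<Sum>n<length Ks. \<Sum>p<d'. (Ks ! n) $$ (p, r) * cnj ((Ks ! n) $$ (p, r')))"
  proof (intro sum.cong refl)
    fix n assume "n \<in> {..<length Ks}"
    then have "Ks ! n \<in> carrier_mat d' dA" using Ks by auto
    then show "(mat_adjoint (Ks ! n) * Ks ! n) $$ (r', r) = (\<Sum>p<d'. (Ks ! n) $$ (p, r) * cnj ((Ks ! n) $$ (p, r')))"
      using r by (simp add: mat_adjoint_eq scalar_prod_def lessThan_atLeast0 mult.commute)
  qed
  finally show ?thesis ..
qed

text \<open>No signalling: Alice's operation does not change Bob's reduced state.\<close>

lemma marginal_conj_sum: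
  assumes K: "\<And>r r'. r < dA \<Longrightarrow> r' < dA \<Longrightarrow>
      (\<Sum>n<length Ks. \<Sum>p<d'. (Ks ! n) $$ (p, r) * cnj ((Ks ! n) $$ (p, r'))) = of_bool (r = r')"
    and st: "s < e" "t < e"
  shows "marginal d' e (conj_sum (length Ks) (dA * e) (\<lambda>n. tensor_one e (Ks ! n)) R) s t = marginal dA e R s t"
proof -
  let ?N = "length Ks" and ?K = "\<lambda>n p r. (Ks ! n) $$ (p, r)"
  have entry: "conj_sum ?N (dA * e) (\<lambda>n. tensor_one e (Ks ! n)) R (p * e + s) (p * e + t)
      = (\<Sum>n<?N. \<Sum>r<dA. \<Sum>r'<dA. ?K n p r * cnj (?K n p r') * R (r * e + s) (r' * e + t))" for p
  proof -
    have "(\<Sum>k<dA * e. \<Sum>l<dA * e. tensor_one e (Ks ! n) (p * e + s) k * R k l * cnj (tensor_one e (Ks ! n) (p * e + t) l))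
      = (\<Sum>r<dA. \<Sum>r'<dA. ?K n p r * cnj (?K n p r') * R (r * e + s) (r' * e + t))" for n
    proof -
      have "(\<Sum>k<dA * e. \<Sum>l<dA * e. tensor_one e (Ks ! n) (p * e + s) k * R k l * cnj (tensor_one e (Ks ! n) (p * e + t) l))
        = (\<Sum>r<dA. \<Sum>s'<e. of_bool (s = s') * (\<Sum>r'<dA. \<Sum>t'<e. of_bool (t = t') *
             (?K n p r * cnj (?K n p r') * R (r * e + s') (r' * e + t'))))"
        unfolding sum_lessThan_mult sum_distrib_left
        by (intro sum.cong refl) (use st in \<open>auto simp: tensor_one_def\<close>)
      then show ?thesis unfolding sum_of_bool_mult using st by simp
    qed
    then show ?thesis by (simp add: conj_sum_def)
  qed
  have "marginal d' e (conj_sum ?N (dA * e) (\<lambda>n. tensor_one e (Ks ! n)) R) s t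
    = (\<Sum>p<d'. \<Sum>n<?N. \<Sum>r<dA. \<Sum>r'<dA. ?K n p r * cnj (?K n p r') * R (r * e + s) (r' * e + t))"
    unfolding marginal_def entry ..
  \<comment> \<open>The sums over Kraus operators and message states are moved innermost, where
    completeness collapses them to a Kronecker delta.\<close>
  also have "\<dots> = (\<Sum>n<?N. \<Sum>p<d'. \<Sum>r<dA. \<Sum>r'<dA. ?K n p r * cnj (?K n p r') * R (r * e + s) (r' * e + t))"
    by (rule sum.swap)
  also have "\<dots> = (\<Sum>n<?N. \<Sum>r<dA. \<Sum>p<d'. \<Sum>r'<dA. ?K n p r * cnj (?K n p r') * R (r * e + s) (r' * e + t))"
    by (intro sum.cong refl sum.swap)
  also have "\<dots> = (\<Sum>n<?N. \<Sum>r<dA. \<Sum>r'<dA. \<Sum>p<d'. ?K n p r * cnj (?K n p r') * R (r * e + s) (r' * e + t))"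
    by (intro sum.cong refl sum.swap)
  also have "\<dots> = (\<Sum>r<dA. \<Sum>n<?N. \<Sum>r'<dA. \<Sum>p<d'. ?K n p r * cnj (?K n p r') * R (r * e + s) (r' * e + t))"
    by (rule sum.swap)
  also have "\<dots> = (\<Sum>r<dA. \<Sum>r'<dA. \<Sum>n<?N. \<Sum>p<d'. ?K n p r * cnj (?K n p r') * R (r * e + s) (r' * e + t))"
    by (intro sum.cong refl sum.swap)
  also have "\<dots> = (\<Sum>r<dA. \<Sum>r'<dA. of_bool (r = r') * R (r * e + s) (r' * e + t))"
    unfolding sum_distrib_right[symmetric] by (intro sum.cong refl) (simp add: K)
  also have "\<dots> = marginal dA e R s t"
    unfolding sum_of_bool_mult marginal_def by (intro sum.cong) auto
  finally show ?thesis .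
qed

section \<open>Mistake trees\<close>

definition smooth :: "nat \<Rightarrow> (nat \<Rightarrow> nat \<Rightarrow> complex) \<Rightarrow> nat \<Rightarrow> nat \<Rightarrow> complex" where
  "smooth d A i j = (A i j + of_bool (i = j) / of_nat d) / 2"

lemma herm_smooth: "herm d A \<Longrightarrow> herm d (smooth d A)"
  unfolding herm_def[of _ "smooth d A"] smooth_def by (auto simp: hermD)

lemma mv_smooth: "i < d \<Longrightarrow> mv d (smooth d A) x i = (mv d A x i + x i / of_nat d) / 2"
proof -
  assume i: "i < d"
  have "mv d (smooth d A) x i = (\<Sum>j<d. A i j * x j / 2 + of_bool (i = j) * (x j / of_nat d / 2))"
    unfolding mv_def smooth_def by (intro sum.cong refl) (simp add: field_simps)
  also have "\<dots> = (mv d A x i + x i / of_nat d) / 2"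
    unfolding sum.distrib sum_of_bool_mult using i by (simp add: mv_def sum_divide_distrib add_divide_distrib)
  finally show ?thesis .
qed

lemma form_smooth: "ip d x (mv d (smooth d A) x) = (ip d x (mv d A x) + ip d x x / of_nat d) / 2"
proof -
  have "ip d x (mv d (smooth d A) x) = (\<Sum>i<d. (cnj (x i) * mv d A x i + cnj (x i) * x i / of_nat d) / 2)"
    unfolding ip_def by (intro sum.cong refl) (simp add: mv_smooth algebra_simps)
  then show ?thesis
    by (simp add: ip_def sum_divide_distrib add_divide_distrib sum.distrib)
qed

lemma trace_smooth:
  assumes "d > 0"
  shows "(\<Sum>i<d. smooth d A i i) = ((\<Sum>i<d. A i i) + 1) / 2"
proof -
  have "(\<Sum>i<d. smooth d A i i) = (\<Sum>i<d. A i i + 1 / of_nat d) / 2"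
    unfolding smooth_def sum_divide_distrib by simp
  then show ?thesis using assms by (simp add: sum.distrib)
qed

text \<open>The offset depends on \<open>E\<close> alone, so mixing merely halves differences of
  expectations between states.\<close>

lemma tr_smooth: "tr d E (smooth d A) = (tr d E A + (\<Sum>i<d. E i i) / of_nat d) / 2"
proof -
  have "(\<Sum>j<d. E i j * smooth d A j i) = (\<Sum>j<d. E i j * A j i / 2) + E i i / of_nat d / 2" if "i < d" for i
  proof -
    have "(\<Sum>j<d. E i j * smooth d A j i) = (\<Sum>j<d. E i j * A j i / 2 + of_bool (j = i) * (E i j / of_nat d / 2))"
      unfolding smooth_def by (intro sum.cong refl) (simp add: field_simps)
    then show ?thesis unfolding sum.distrib sum_of_bool_mult using that by simp
  qed
  then show ?thesis
    unfolding tr_def by (simp add: sum.distrib sum_divide_distrib add_divide_distrib)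
qed

text \<open>A density matrix with eigenvalues at least \<epsilon>. One \<epsilon> serves a whole
  tree because the class is closed under midpoints.\<close>

definition pdens :: "nat \<Rightarrow> real \<Rightarrow> (nat \<Rightarrow> nat \<Rightarrow> complex) \<Rightarrow> bool" where
  "pdens d \<epsilon> A \<longleftrightarrow> herm d A \<and> (\<forall>x. \<epsilon> * Re (ip d x x) \<le> Re (ip d x (mv d A x))) \<and> (\<Sum>i<d. A i i) = 1"

lemma pdens_spectral:
  assumes "pdens d \<epsilon> A" "spectral d A a u"
  shows "k < d \<Longrightarrow> \<epsilon> \<le> a k" "(\<Sum>k<d. a k) = 1"
proof -
  have u: "onb d u" using assms by (simp add: spectral_def)
  show "\<epsilon> \<le> a k" if "k < d"
  proof -
    have "\<epsilon> * Re (ip d (u k) (u k)) \<le> Re (ip d (u k) (mv d A (u k)))"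
      using assms(1) unfolding pdens_def by blast
    then show ?thesis using spectral_value[OF assms(2) that] onb_norm[OF u that] by simp
  qed
  show "(\<Sum>k<d. a k) = 1"
    using assms(1) spectral_trace[OF assms(2)] unfolding pdens_def by (metis of_real_eq_iff of_real_1)
qed

lemma pdens_smooth:
  assumes "pos d A" "(\<Sum>i<d. A i i) = 1" "d > 0"
  shows "pdens d (1 / (2 * real d)) (smooth d A)"
proof -
  have "1 / (2 * real d) * Re (ip d x x) \<le> Re (ip d x (mv d (smooth d A) x))" for x
  proof -
    have "0 \<le> Re (ip d x (mv d A x))" using assms(1) by (simp add: pos_def less_eq_complex_def)
    moreover have "Re (ip d x (mv d (smooth d A) x)) = (Re (ip d x (mv d A x)) + Re (ip d x x) / real d) / 2"
      unfolding form_smooth by (simp add: ip_self)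
    ultimately show ?thesis by simp
  qed
  then show ?thesis
    using herm_smooth[OF pos_herm[OF assms(1)]] trace_smooth[OF assms(3), of A] assms(2) by (simp add: pdens_def)
qed

lemma pdens_midpoint:
  assumes "pdens d \<epsilon> A0" "pdens d \<epsilon> A1"
  shows "pdens d \<epsilon> (\<lambda>i j. (A0 i j + A1 i j) / 2)"
proof -
  have "mv d (\<lambda>i j. (A0 i j + A1 i j) / 2) x i = (mv d A0 x i + mv d A1 x i) / 2" for x i
    unfolding mv_def sum.distrib[symmetric] sum_divide_distrib
    by (intro sum.cong refl) (simp add: field_simps)
  then have ip: "ip d x (mv d (\<lambda>i j. (A0 i j + A1 i j) / 2) x) = (ip d x (mv d A0 x) + ip d x (mv d A1 x)) / 2" for x
    unfolding ip_def sum.distrib[symmetric] sum_divide_distrib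
    by (intro sum.cong refl) (simp add: field_simps)
  have form: "Re (ip d x (mv d (\<lambda>i j. (A0 i j + A1 i j) / 2) x))
      = (Re (ip d x (mv d A0 x)) + Re (ip d x (mv d A1 x))) / 2" for x
    unfolding ip by simp
  have le: "\<epsilon> * Re (ip d x x) \<le> Re (ip d x (mv d A0 x))" "\<epsilon> * Re (ip d x x) \<le> Re (ip d x (mv d A1 x))" for x
    using assms unfolding pdens_def by blast+
  have "\<epsilon> * Re (ip d x x) \<le> Re (ip d x (mv d (\<lambda>i j. (A0 i j + A1 i j) / 2) x))" for x
  proof -
    have mean: "r \<le> s \<Longrightarrow> r \<le> t \<Longrightarrow> r \<le> (s + t) / 2" for r s t :: real by simp
    show ?thesis unfolding form by (rule mean[OF le])
  qed
  moreover have "(\<Sum>i<d. (A0 i i + A1 i i) / 2) = 1"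
    using assms unfolding pdens_def sum_divide_distrib[symmetric] sum.distrib by simp
  moreover have "herm d (\<lambda>i j. (A0 i j + A1 i j) / 2)"
    using assms unfolding pdens_def herm_def[of _ "\<lambda>i j. (A0 i j + A1 i j) / 2"] by (auto simp: hermD)
  ultimately show ?thesis by (simp add: pdens_def)
qed

section \<open>Decrease of relative entropy along a mistake tree\<close>

text \<open>
  \<open>mistake_tree f Y n X\<close>: inside \<open>X\<close> there is a complete binary tree of depth \<open>n\<close>, with points of
  \<open>Y\<close> at the inner nodes, all of whose branches are realised by \<open>f\<close> (Littlestone's dimension).
\<close>

fun mistake_tree :: "('x \<Rightarrow> 'y \<Rightarrow> bool option) \<Rightarrow> 'y set \<Rightarrow> nat \<Rightarrow> 'x set \<Rightarrow> bool" where
  "mistake_tree f Y 0 X \<longleftrightarrow> X \<noteq> {}"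
| "mistake_tree f Y (Suc n) X \<longleftrightarrow>
     (\<exists>y\<in>Y. \<forall>z. mistake_tree f Y n {x \<in> X. f x y = Some z})"

text \<open>Induction on the depth. The witness \<open>A\<close> is an average of leaf states, a
  fact kept only through its consequence for linear functionals. At a leaf, domination gives ln c.
  At an inner node, the midpoint differs from each child by at least g / 2 in the expectation of
  \<open>E y\<close>; Pinsker gives (g / 2)^2 / 4, which \<open>relent_midpoint\<close>
  subtracts.\<close>

lemma mistake_tree_relent:
  fixes \<sigma> :: "'x \<Rightarrow> nat \<Rightarrow> nat \<Rightarrow> complex" and E :: "'y \<Rightarrow> nat \<Rightarrow> nat \<Rightarrow> complex"
  assumes \<epsilon>: "\<epsilon> > 0" and \<sigma>: "\<And>x. x \<in> V \<Longrightarrow> pdens d \<epsilon> (\<sigma> x)"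
    and W: "pdens d \<epsilon> W" "spectral d W b v" and c: "c > 0"
    and dom: "\<And>x w. x \<in> V \<Longrightarrow> Re (ip d w (mv d (\<sigma> x) w)) \<le> c * Re (ip d w (mv d W w))"
    and E: "\<And>y. y \<in> Y \<Longrightarrow> herm d (E y)"
    and E1: "\<And>y w. y \<in> Y \<Longrightarrow> Re (ip d (mv d (E y) w) (mv d (E y) w)) \<le> Re (ip d w w)"
    and hi: "\<And>x y. x \<in> V \<Longrightarrow> y \<in> Y \<Longrightarrow> f x y = Some True \<Longrightarrow> \<theta> y + g \<le> Re (tr d (E y) (\<sigma> x))"
    and lo: "\<And>x y. x \<in> V \<Longrightarrow> y \<in> Y \<Longrightarrow> f x y = Some False \<Longrightarrow> Re (tr d (E y) (\<sigma> x)) \<le> \<theta> y"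
    and g: "g \<ge> 0"
  shows "mistake_tree f Y n X \<Longrightarrow> X \<subseteq> V \<Longrightarrow>
    \<exists>A a u. pdens d \<epsilon> A \<and> spectral d A a u \<and> relent d a u b v \<le> ln c - n * (g\<^sup>2 / 16) \<and>
      (\<forall>F t. (\<forall>x\<in>X. t \<le> Re (tr d F (\<sigma> x))) \<longrightarrow> t \<le> Re (tr d F A))"
proof (induction n arbitrary: X)
  case 0
  then obtain x where x: "x \<in> X" "x \<in> V" by auto
  obtain a u where A: "spectral d (\<sigma> x) a u" using spectral_theorem \<sigma>[OF x(2)] pdens_def by blast
  have "relent d a u b v \<le> ln c"
    by (rule relent_le[OF A W(2) _ _ _ c dom[OF x(2)]])
       (use \<epsilon> pdens_spectral[OF \<sigma>[OF x(2)] A] pdens_spectral[OF W] in \<open>auto intro: less_le_trans\<close>)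
  then show ?case using x A \<sigma>[OF x(2)] by (intro exI[of _ "\<sigma> x"] exI[of _ a] exI[of _ u]) auto
next
  case (Suc n)
  then obtain y where y: "y \<in> Y" and tree: "\<And>z. mistake_tree f Y n {x \<in> X. f x y = Some z}" by auto
  define Z where "Z z = {x \<in> X. f x y = Some z}" for z
  have ZV: "Z z \<subseteq> V" for z using Suc.prems(2) by (auto simp: Z_def)
  have "\<forall>z. \<exists>A a u. pdens d \<epsilon> A \<and> spectral d A a u \<and> relent d a u b v \<le> ln c - n * (g\<^sup>2 / 16) \<and>
      (\<forall>F t. (\<forall>x\<in>Z z. t \<le> Re (tr d F (\<sigma> x))) \<longrightarrow> t \<le> Re (tr d F A))"
    using Suc.IH[OF tree] ZV unfolding Z_def by blast
  then obtain A a u where A: "\<And>z. pdens d \<epsilon> (A z)" "\<And>z. spectral d (A z) (a z) (u z)"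
    and rel: "\<And>z. relent d (a z) (u z) b v \<le> ln c - n * (g\<^sup>2 / 16)"
    and conv: "\<And>z F t. (\<And>x. x \<in> Z z \<Longrightarrow> t \<le> Re (tr d F (\<sigma> x))) \<Longrightarrow> t \<le> Re (tr d F (A z))"
    by metis
  define B where "B i j = (A False i j + A True i j) / 2" for i j
  have B: "pdens d \<epsilon> B" using pdens_midpoint[OF A(1) A(1), of False True] by (simp add: B_def[abs_def])
  obtain b' w where Bs: "spectral d B b' w" using spectral_theorem B pdens_def by blast
  have trB: "tr d F B = (tr d F (A False) + tr d F (A True)) / 2" for F
    unfolding tr_def B_def add_divide_distrib sum_divide_distrib sum.distrib[symmetric]
    by (intro sum.cong refl) (simp add: algebra_simps add_divide_distrib)
  have T: "\<theta> y + g \<le> Re (tr d (E y) (A True))"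
    using hi y ZV[of True] by (intro conv) (auto simp: Z_def)
  \<comment> \<open>The induction hypothesis transfers lower bounds only. Applied to the negated
    observable it gives the upper bound for the \<open>False\<close> child.\<close>
  have neg: "tr d (\<lambda>i j. - E y i j) M = - tr d (E y) M" for M
    by (simp add: tr_def sum_negf)
  have "- \<theta> y \<le> Re (tr d (\<lambda>i j. - E y i j) (A False))"
    using lo y ZV[of False] by (intro conv) (auto simp: Z_def neg)
  then have F: "Re (tr d (E y) (A False)) \<le> \<theta> y" by (simp add: neg)
  have gain: "g\<^sup>2 / 16 \<le> relent d (a z) (u z) b' w" for z
  proof -
    have "g \<le> Re (tr d (E y) (A True)) - Re (tr d (E y) (A False))" using T F by simp
    then have "g\<^sup>2 \<le> (Re (tr d (E y) (A True)) - Re (tr d (E y) (A False)))\<^sup>2"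
      using g by (intro power_mono)
    also have "\<dots> = 4 * (Re (tr d (E y) (A z)) - Re (tr d (E y) B))\<^sup>2"
      unfolding trB by (cases z) (simp_all add: power2_eq_square field_simps)
    finally have "g\<^sup>2 / 16 \<le> (Re (tr d (E y) (A z)) - Re (tr d (E y) B))\<^sup>2 / 4" by simp
    also have "\<dots> \<le> relent d (a z) (u z) b' w"
      by (rule relent_ge[OF A(2) Bs _ _ _ _ E[OF y] E1[OF y]])
         (use \<epsilon> pdens_spectral[OF A] pdens_spectral[OF B Bs] in \<open>auto intro: less_le_trans\<close>)
    finally show ?thesis .
  qed
  have v: "onb d v" using W(2) by (simp add: spectral_def)
  have "relent d b' w b v = (relent d (a False) (u False) b v + relent d (a True) (u True) b v) / 2
     - (relent d (a False) (u False) b' w + relent d (a True) (u True) b' w) / 2"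
    by (rule relent_midpoint[OF A(2) A(2) Bs v]) (simp add: B_def)
  also have "\<dots> \<le> ln c - real (Suc n) * (g\<^sup>2 / 16)"
    using rel[of False] rel[of True] gain[of False] gain[of True] by (simp add: algebra_simps add_divide_distrib)
  finally have "relent d b' w b v \<le> ln c - real (Suc n) * (g\<^sup>2 / 16)" .
  moreover have "t \<le> Re (tr d F B)" if "\<forall>x\<in>X. t \<le> Re (tr d F (\<sigma> x))" for F t
    using that conv[of False t F] conv[of True t F] by (auto simp: trB Z_def)
  ultimately show ?case using B Bs by blast
qed

lemma mistake_tree_bound:
  fixes \<sigma> :: "'x \<Rightarrow> nat \<Rightarrow> nat \<Rightarrow> complex" and E :: "'y \<Rightarrow> nat \<Rightarrow> nat \<Rightarrow> complex"
  assumes \<epsilon>: "\<epsilon> > 0" and \<sigma>: "\<And>x. x \<in> V \<Longrightarrow> pdens d \<epsilon> (\<sigma> x)"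
    and W: "pdens d \<epsilon> W" and c: "c > 0"
    and dom: "\<And>x w. x \<in> V \<Longrightarrow> Re (ip d w (mv d (\<sigma> x) w)) \<le> c * Re (ip d w (mv d W w))"
    and E: "\<And>y. y \<in> Y \<Longrightarrow> herm d (E y)"
    and E1: "\<And>y w. y \<in> Y \<Longrightarrow> Re (ip d (mv d (E y) w) (mv d (E y) w)) \<le> Re (ip d w w)"
    and hi: "\<And>x y. x \<in> V \<Longrightarrow> y \<in> Y \<Longrightarrow> f x y = Some True \<Longrightarrow> \<theta> y + g \<le> Re (tr d (E y) (\<sigma> x))"
    and lo: "\<And>x y. x \<in> V \<Longrightarrow> y \<in> Y \<Longrightarrow> f x y = Some False \<Longrightarrow> Re (tr d (E y) (\<sigma> x)) \<le> \<theta> y"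
    and g: "g \<ge> 0" and tree: "mistake_tree f Y n V"
  shows "n * (g\<^sup>2 / 16) \<le> ln c"
proof -
  obtain b v where Ws: "spectral d W b v" using spectral_theorem W pdens_def by blast
  obtain A a u where A: "pdens d \<epsilon> A" "spectral d A a u" and rel: "relent d a u b v \<le> ln c - n * (g\<^sup>2 / 16)"
    using mistake_tree_relent[where V = V and Y = Y and f = f and \<sigma> = \<sigma> and E = E and \<theta> = \<theta>, OF \<epsilon> \<sigma> W Ws c dom E E1 hi lo g tree order.refl] by blast
  \<comment> \<open>With the zero observable, Pinsker's inequality says that relative entropy is
    nonnegative.\<close>
  have "(Re (tr d (\<lambda>_ _. 0) A) - Re (tr d (\<lambda>_ _. 0) W))\<^sup>2 / 4 \<le> relent d a u b v"
    by (rule relent_ge[OF A(2) Ws])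
       (use \<epsilon> pdens_spectral[OF A] pdens_spectral[OF W Ws] in
         \<open>auto intro: less_le_trans simp: herm_def mv_def ip_self ip_def[of _ "\<lambda>_. 0"] sum_nonneg\<close>)
  then show ?thesis using rel by (simp add: tr_def)
qed

section \<open>From a mistake bound to a deterministic protocol\<close>

text \<open>
  The message lists the points where Littlestone's optimal online learner errs; the correct values
  are the negated predictions and need not be sent.
\<close>

lemma encode_mistakes:
  fixes f :: "'x \<Rightarrow> bool list \<Rightarrow> bool option"
  assumes "\<not> mistake_tree f {y. length y = m} (Suc n) X"
  shows "\<exists>msg out. \<forall>x\<in>X. length (msg x) = n * (m + 1) \<and>
    (\<forall>y z. length y = m \<longrightarrow> f x y = Some z \<longrightarrow> out (msg x :: bool list) y = z)"
  using assms
proof (induction n arbitrary: X)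
  case 0
  then have "\<forall>y. \<exists>z. length y = m \<longrightarrow> {x \<in> X. f x y = Some z} = {}" by auto
  \<comment> \<open>\<open>z y\<close> is a value that no element of \<open>X\<close> takes at
    \<open>y\<close>, so its negation is correct wherever the function is defined.\<close>
  then obtain z where z: "\<And>y. length y = m \<Longrightarrow> {x \<in> X. f x y = Some (z y)} = {}" by metis
  have "(\<not> z y) = z'" if "x \<in> X" "length y = m" "f x y = Some z'" for x y z'
  proof -
    have "f x y \<noteq> Some (z y)" using z[OF that(2)] that(1) by blast
    then show ?thesis using that(3) by auto
  qed
  then show ?case by (intro exI[of _ "\<lambda>_. []"] exI[of _ "\<lambda>_ y. \<not> z y"]) auto
next
  case (Suc n)
  let ?Y = "{y :: bool list. length y = m}"
  from Suc.prems have "\<forall>y. \<exists>z. y \<in> ?Y \<longrightarrow> \<not> mistake_tree f ?Y (Suc n) {x \<in> X. f x y = Some z}"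
    by (subst (asm) mistake_tree.simps) blast
  \<comment> \<open>\<open>z y\<close> is a value whose restriction lowers the tree depth. The
    learner predicts the negation, so each error leaves a class with a smaller mistake
    bound.\<close>
  then obtain z where z: "\<And>y. y \<in> ?Y \<Longrightarrow> \<not> mistake_tree f ?Y (Suc n) {x \<in> X. f x y = Some (z y)}"
    by metis
  have "\<forall>y. \<exists>msg out. y \<in> ?Y \<longrightarrow> (\<forall>x\<in>{x \<in> X. f x y = Some (z y)}. length (msg x) = n * (m + 1) \<and>
    (\<forall>y' z. length y' = m \<longrightarrow> f x y' = Some z \<longrightarrow> out (msg x :: bool list) y' = z))"
    using Suc.IH[OF z] by blast
  then obtain msg out where mo: "\<And>y x. y \<in> ?Y \<Longrightarrow> x \<in> X \<Longrightarrow> f x y = Some (z y) \<Longrightarrow> length (msg y x) = n * (m + 1) \<and>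
    (\<forall>y' z. length y' = m \<longrightarrow> f x y' = Some z \<longrightarrow> out y (msg y x :: bool list) y' = z)"
    by (simp only: mem_Collect_eq choice_iff) blast
  define err where "err x y \<longleftrightarrow> y \<in> ?Y \<and> f x y = Some (z y)" for x y
  \<comment> \<open>A round takes \<open>m + 1\<close> bits: the flag \<open>True\<close> and a
    point of error, followed by the message for the restricted class. A leading \<open>False\<close>
    means that no error remains; padding keeps the length fixed.\<close>
  define msg' where "msg' x = (if \<exists>y. err x y
      then let y = SOME y. err x y in True # y @ msg y x else replicate (Suc n * (m + 1)) False)" for x
  define out' where "out' s y = (if hd s then out (take m (tl s)) (drop m (tl s)) y else \<not> z y)" for s y
  have "length (msg' x) = Suc n * (m + 1) \<and>
    (\<forall>y z. length y = m \<longrightarrow> f x y = Some z \<longrightarrow> out' (msg' x) y = z)" if x: "x \<in> X" for x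
  proof (cases "\<exists>y. err x y")
    case True
    define y where "y = (SOME y. err x y)"
    have "err x y" unfolding y_def using True by (rule someI_ex)
    then have y: "y \<in> ?Y" "f x y = Some (z y)" by (auto simp: err_def)
    have "msg' x = True # y @ msg y x" using True by (simp add: msg'_def y_def Let_def)
    then show ?thesis using y mo[OF y(1) x y(2)] by (simp add: out'_def)
  next
    case False
    then have "msg' x = replicate (Suc n * (m + 1)) False" by (simp add: msg'_def)
    then show ?thesis using False by (auto simp: out'_def err_def)
  qed
  then show ?case by blast
qed

section \<open>From an entangled protocol to a bound on mistake trees\<close>

lemma ent_protocol_mistake_tree:
  assumes prot: "ent_protocol n m f q a b \<rho> Ks M"
    and tree: "mistake_tree f {y. length y = m} N {x. length x = n}"
  shows "N \<le> 1152 * q"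
proof -
  define d where "d = (2 ^ q * 2 ^ b :: nat)"
  have d: "d > 0" by (simp add: d_def)
  define R where "R i j = \<rho> $$ (i, j)" for i j
  define \<tau> where "\<tau> x = conj_sum (length (Ks x)) (2 ^ a * 2 ^ b) (\<lambda>n. tensor_one (2 ^ b) (Ks x ! n)) R" for x
  define \<omega> where "\<omega> = (\<lambda>i j. ampl (2 ^ b) (marginal (2 ^ a) (2 ^ b) R) i j / 2 ^ q)"
  define E where "E y i j = M y True $$ (i, j)" for y i j
  have dens: "psd (2 ^ a * 2 ^ b) \<rho>" "mat_trace \<rho> = 1" using prot by (auto simp: ent_protocol_def density_def)
  have R: "pos (2 ^ a * 2 ^ b) R" using psd_pos[OF dens(1)] by (simp add: R_def[abs_def])
  have \<rho>: "\<rho> \<in> carrier_mat (2 ^ a * 2 ^ b) (2 ^ a * 2 ^ b)" using dens(1) by (simp add: psd_def)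
  have marg_trace: "(\<Sum>s<2 ^ b. marginal (2 ^ a) (2 ^ b) R s s) = 1"
  proof -
    have "(\<Sum>s<2 ^ b. marginal (2 ^ a) (2 ^ b) R s s) = (\<Sum>i<2 ^ a * 2 ^ b. R i i)"
      unfolding marginal_def sum_lessThan_mult by (rule sum.swap)
    also have "\<dots> = mat_trace \<rho>" using \<rho> by (simp add: mat_trace_def R_def)
    finally show ?thesis using dens(2) by simp
  qed
  have \<tau>: "pos d (\<tau> x)" for x unfolding d_def \<tau>_def by (rule pos_conj_sum[OF R])
  have op: "quantum_op (2 ^ a) (2 ^ q) (Ks x)" if "length x = n" for x
    using prot that by (auto simp: ent_protocol_def)
  have marg: "marginal (2 ^ q) (2 ^ b) (\<tau> x) s t = marginal (2 ^ a) (2 ^ b) R s t"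
    if "length x = n" "s < 2 ^ b" "t < 2 ^ b" for x s t
    unfolding \<tau>_def using kraus_complete[OF op[OF that(1)]] that(2,3) by (rule marginal_conj_sum)
  have \<tau>_trace: "(\<Sum>i<d. \<tau> x i i) = 1" if "length x = n" for x
  proof -
    have "(\<Sum>i<d. \<tau> x i i) = (\<Sum>s<2 ^ b. marginal (2 ^ q) (2 ^ b) (\<tau> x) s s)"
      unfolding marginal_def d_def sum_lessThan_mult by (rule sum.swap)
    then show ?thesis using marg[OF that] marg_trace by simp
  qed
  \<comment> \<open>No signalling allows \<omega>, built from the initial state, to be rewritten
    with the marginal of \<tau> at any valid input.\<close>
  have \<omega>_form: "ip d w (mv d \<omega> w) = ip d w (mv d (ampl (2 ^ b) (marginal (2 ^ q) (2 ^ b) (\<tau> x))) w) / 2 ^ q"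
    if "length x = n" for x w
  proof -
    have "ip d w (mv d \<omega> w) = ip d w (mv d (ampl (2 ^ b) (marginal (2 ^ a) (2 ^ b) R)) w) / 2 ^ q"
      by (simp add: \<omega>_def ip_def mv_def sum_divide_distrib[symmetric])
    also have "mv d (ampl (2 ^ b) (marginal (2 ^ a) (2 ^ b) R)) w
        = mv d (ampl (2 ^ b) (marginal (2 ^ q) (2 ^ b) (\<tau> x))) w"
      by (intro ext) (simp add: mv_def ampl_def marg[OF that])
    finally show ?thesis .
  qed
  have \<omega>: "pos d \<omega>"
    unfolding pos_def
  proof
    fix w
    \<comment> \<open>Some concrete input is needed here, to view \<omega> through a state
      \<tau>.\<close>
    have x: "length (replicate n True) = n" by simp
    show "0 \<le> ip d w (mv d \<omega> w)"
      using pos_le_ampl_marginal(2)[OF \<tau>[unfolded d_def]]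
      unfolding \<omega>_form[OF x] unfolding d_def by (auto simp: less_eq_complex_def)
  qed
  have \<omega>_trace: "(\<Sum>i<d. \<omega> i i) = 1"
  proof -
    have "(\<Sum>i<d. \<omega> i i) = (\<Sum>p<(2 ^ q :: nat). (\<Sum>s<2 ^ b. marginal (2 ^ a) (2 ^ b) R s s) / 2 ^ q)"
      unfolding d_def sum_lessThan_mult sum_divide_distrib by (simp add: \<omega>_def ampl_def)
    then show ?thesis unfolding marg_trace by simp
  qed
  have dom: "Re (ip d w (mv d (smooth d (\<tau> x)) w)) \<le> 4 ^ q * Re (ip d w (mv d (smooth d \<omega>) w))"
    if x: "length x = n" for x w
  proof -
    have "Re (ip d w (mv d (\<tau> x) w))
        \<le> 2 ^ q * Re (ip d w (mv d (ampl (2 ^ b) (marginal (2 ^ q) (2 ^ b) (\<tau> x))) w))"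
      using pos_le_ampl_marginal(1)[OF \<tau>[unfolded d_def]] unfolding d_def by simp
    also have "\<dots> = 4 ^ q * Re (ip d w (mv d \<omega> w))"
    proof -
      \<comment> \<open>One factor 2^q is the dimension of the message in
        \<open>pos_le_ampl_marginal\<close>, the other undoes the normalisation of \<omega>.\<close>
      have "4 ^ q = (2 ^ q * 2 ^ q :: real)" by (simp flip: power_mult_distrib)
      moreover have "Re (z / 2 ^ q) = Re z / 2 ^ q" for z
        by (metis Re_divide_of_real of_real_numeral of_real_power)
      ultimately show ?thesis unfolding \<omega>_form[OF x] by simp
    qed
    finally have 1: "Re (ip d w (mv d (\<tau> x) w)) \<le> 4 ^ q * Re (ip d w (mv d \<omega> w))" .
    have 2: "Re (ip d w w / of_nat d) \<le> 4 ^ q * Re (ip d w w / of_nat d)"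
      using mult_right_mono[of 1 "4 ^ q" "Re (ip d w w / of_nat d)"]
      by (simp add: ip_self sum_nonneg)
    show ?thesis using 1 2 unfolding form_smooth by (simp add: algebra_simps)
  qed
  have povm: "psd d (M y False)" "psd d (M y True)" "M y False + M y True = 1\<^sub>m d" if "length y = m" for y
    using prot that by (auto simp: ent_protocol_def binary_povm_def d_def)
  have E0: "pos d (E y)" if "length y = m" for y
    using psd_pos[OF povm(2)[OF that]] by (simp add: E_def[abs_def])
  have compl: "M y False $$ (i, j) = of_bool (i = j) - E y i j" if "length y = m" "i < d" "j < d" for y i j
  proof -
    have "(M y False + M y True) $$ (i, j) = M y False $$ (i, j) + E y i j"
      using povm(2)[OF that(1)] that(2,3) by (auto simp: psd_def E_def)
    then show ?thesis using povm(3)[OF that(1)] that(2,3) by (cases "i = j") (simp_all add: eq_diff_eq eq_neg_iff_add_eq_0)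
  qed
  have E1: "Re (ip d w (mv d (E y) w)) \<le> Re (ip d w w)" if y: "length y = m" for y w
  proof -
    have "mv d (\<lambda>i j. M y False $$ (i, j)) w i = w i - mv d (E y) w i" if "i < d" for i
    proof -
      have "mv d (\<lambda>i j. M y False $$ (i, j)) w i = (\<Sum>j<d. of_bool (i = j) * w j - E y i j * w j)"
        unfolding mv_def using that by (intro sum.cong refl) (simp add: compl[OF y] algebra_simps)
      then show ?thesis unfolding sum_subtractf sum_of_bool_mult using that by (simp add: mv_def)
    qed
    then have "ip d w (mv d (\<lambda>i j. M y False $$ (i, j)) w) = ip d w w - ip d w (mv d (E y) w)"
      unfolding ip_def sum_subtractf[symmetric] by (intro sum.cong refl) (simp add: right_diff_distrib)
    moreover have "0 \<le> Re (ip d w (mv d (\<lambda>i j. M y False $$ (i, j)) w))"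
      using psd_pos[OF povm(1)[OF y]] unfolding pos_def less_eq_complex_def by auto
    ultimately show ?thesis by simp
  qed
  have prob: "outcome_prob (M y) (apply_first (2 ^ q) (2 ^ b) (Ks x) \<rho>) z = Re (tr d (\<lambda>i j. M y z $$ (i, j)) (\<tau> x))"
    if x: "length x = n" and y: "length y = m" for x y z
  proof -
    let ?S = "apply_first (2 ^ q) (2 ^ b) (Ks x) \<rho>"
    have Kc: "set (Ks x) \<subseteq> carrier_mat (2 ^ q) (2 ^ a)" using op[OF x] by (simp add: quantum_op_def)
    have S: "?S $$ (i, j) = \<tau> x i j" if "i < d" "j < d" for i j
      using apply_first_entry[OF Kc \<rho>] that by (simp add: \<tau>_def d_def R_def[abs_def])
    have Sc: "?S \<in> carrier_mat d d"
      using apply_first_carrier[OF Kc \<rho>] by (simp add: d_def)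
    have Mc: "M y z \<in> carrier_mat d d" using povm[OF y] by (cases z) (auto simp: psd_def)
    have "mat_trace (M y z * ?S) = (\<Sum>i<d. \<Sum>j<d. M y z $$ (i, j) * ?S $$ (j, i))"
      using Mc Sc by (simp add: mat_trace_def scalar_prod_def lessThan_atLeast0)
    also have "\<dots> = tr d (\<lambda>i j. M y z $$ (i, j)) (\<tau> x)"
      unfolding tr_def by (intro sum.cong refl) (simp add: S)
    finally show ?thesis by (simp add: outcome_prob_def)
  qed
  have correct: "Re (tr d (\<lambda>i j. M y z $$ (i, j)) (\<tau> x)) \<ge> 2 / 3"
    if "length x = n" "length y = m" "f x y = Some z" for x y z
    using prot that unfolding ent_protocol_def by (metis prob)
  \<comment> \<open>Acceptance probability at most 1/3 becomes at most 1/6 after halving, and at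
    least 2/3 becomes at least 1/3. The second summand is the offset of the maximally mixed
    part.\<close>
  define \<theta> where "\<theta> y = 1 / 6 + Re ((\<Sum>i<d. E y i i) / of_nat d) / 2" for y
  have tr_E: "Re (tr d (E y) (smooth d (\<tau> x))) = Re (tr d (E y) (\<tau> x)) / 2 + \<theta> y - 1 / 6" for x y
    unfolding tr_smooth \<theta>_def by simp
  \<comment> \<open>The gap 1/3 between acceptance probabilities is halved by smoothing, so g = 1/6
    and every level costs 1/576. With ln (4^q) \<le> 2 q this yields 1152 q.\<close>
  have "N * ((1 / 6)\<^sup>2 / 16) \<le> ln (4 ^ q :: real)"
  proof (rule mistake_tree_bound[where \<sigma> = "\<lambda>x. smooth d (\<tau> x)" and W = "smooth d \<omega>" and E = E and \<theta> = \<theta>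
        and d = d and \<epsilon> = "1 / (2 * real d)", OF _ _ _ _ _ _ _ _ _ _ tree], goal_cases)
    case (2 x)
    then show ?case using pdens_smooth[OF \<tau> \<tau>_trace d] by simp
  next
    case 3
    show ?case by (rule pdens_smooth[OF \<omega> \<omega>_trace d])
  next
    case (5 x w)
    then show ?case using dom by simp
  next
    case (6 y)
    then show ?case using pos_herm[OF E0] by simp
  next
    case (7 y w)
    then have y: "length y = m" by simp
    show ?case
      by (rule effect_contraction[OF pos_herm[OF E0[OF y]] _ E1[OF y]])
         (use E0[OF y] in \<open>simp add: pos_def less_eq_complex_def\<close>)
  next
    case (8 x y)
    then show ?case using correct[of x y True] unfolding tr_E by (simp add: E_def[abs_def])
  next
    case (9 x y)
    then have xy: "length x = n" "length y = m" by simp_all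
    have "tr d (\<lambda>i j. M y False $$ (i, j)) (\<tau> x) = (\<Sum>i<d. \<Sum>j<d. of_bool (i = j) * \<tau> x j i - E y i j * \<tau> x j i)"
      unfolding tr_def by (intro sum.cong refl) (simp add: compl[OF xy(2)] left_diff_distrib)
    also have "\<dots> = (\<Sum>i<d. \<tau> x i i) - tr d (E y) (\<tau> x)"
      unfolding tr_def sum_subtractf sum_of_bool_mult by simp
    finally show ?case using correct[OF xy 9(3)] \<tau>_trace[OF xy(1)] unfolding tr_E by simp
  qed (use d in auto)
  also have "ln (4 ^ q :: real) = q * (2 * ln 2)"
    using ln_realpow[of 4 q] ln_realpow[of "2 :: real" 2] by simp
  also have "\<dots> \<le> real q * (2 * 1)"
    using ln_le_minus_one[of "2 :: real"] by (intro mult_left_mono) auto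
  finally have "real N \<le> 1152 * real q" by (simp add: power2_eq_square)
  then show ?thesis by linarith
qed

theorem mainTheorem1:
  shows "\<exists>K :: real. K > 0 \<and>
    (\<forall>(n :: nat) (m :: nat) (f :: bool list \<Rightarrow> bool list \<Rightarrow> bool option).
       n > 0 \<longrightarrow> m > 0 \<longrightarrow>
       real (det_one_way n m f) \<le> K * real (ent_one_way n m f) * real m)"
proof (intro exI[of _ 2304] conjI allI impI)
  fix n m :: nat and f :: "bool list \<Rightarrow> bool list \<Rightarrow> bool option"
  assume m: "m > 0"
  define q where "q = ent_one_way n m f"
  have "\<exists>a b \<rho> Ks M. ent_protocol n m f q a b \<rho> Ks M"
    unfolding q_def ent_one_way_def by (rule LeastI) (rule ent_protocol_exists)
  \<comment> \<open>Excluding depth \<open>Suc (1152 * q)\<close> is what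
    \<open>encode_mistakes\<close> asks for in order to use \<open>1152 * q\<close> rounds. There is
    no additive term, so q = 0 gives an empty message.\<close>
  then have "\<not> mistake_tree f {y. length y = m} (Suc (1152 * q)) {x. length x = n}"
    using ent_protocol_mistake_tree by fastforce
  from encode_mistakes[OF this] obtain msg :: "bool list \<Rightarrow> bool list" and out where
    "\<forall>x\<in>{x. length x = n}. length (msg x) = (1152 * q) * (m + 1) \<and>
      (\<forall>y z. length y = m \<longrightarrow> f x y = Some z \<longrightarrow> out (msg x) y = z)" by blast
  then have "det_protocol n m f ((1152 * q) * (m + 1)) msg out" by (simp add: det_protocol_def)
  then have "det_one_way n m f \<le> (1152 * q) * (m + 1)"
    unfolding det_one_way_def by (intro Least_le) blast
  \<comment> \<open>For positive \<open>m\<close>, m + 1 \<le> 2 m absorbs the flag bits and doubles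
    1152 to 2304.\<close>
  also have "\<dots> \<le> (1152 * q) * (2 * m)" using m by (intro mult_left_mono) auto
  finally have "real (det_one_way n m f) \<le> real ((1152 * q) * (2 * m))" by (rule of_nat_mono)
  then show "real (det_one_way n m f) \<le> 2304 * real (ent_one_way n m f) * real m"
    by (simp add: q_def)
qed simp

end
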